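(* Let $\sigma=(\sigma_1,\sigma_2)$ satisfy $0\le\sigma_2\le\sigma_1<1$ and $\sqrt{1-\sigma_1^2}+\sqrt{1-\sigma_2^2}>1$, and let $g=g_\sigma=1+\sigma_1z_1^2+\sigma_2z_2^2$. Let \[ \mathcal A_g=\{H\in\operatorname{Herm}_9:\mathbf V^*H\mathbf V=|g|^2\text{ on }\partial\mathbb B^2\},\qquad \mathcal S_g^{\mathrm{fr}}=\{H\in\mathcal A_g:H>0\}. \] Then the affine space $\mathcal A_g$ has real dimension $25$, and $\mathcal S_g^{\mathrm{fr}}$ is nonempty and relatively open in $\mathcal A_g$. Modulo unitary transformations of the target, the points of $\mathcal S_g^{\mathrm{fr}}$ parametrize precisely the normalized sphere maps $P/g$ with $\deg P\le 3$ and denominator $g$ that have full rank, in the minimal target $\mathbb B^9$ or, stably, in a larger ball after adjoining zero coordinates; here a numerator $P=C\mathbf V$ corresponds to the Gram matrix $H=C^*C$.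
   Context: $\operatorname{Herm}_9$ is the real vector space of $9\times9$ Hermitian matrices; $H>0$ means positive definite; $^*$ is the conjugate transpose. $\mathbf V=\mathbf V(z)$ is the column of length 9 with entries $z_1,z_2,\ z_1^2,\sqrt2z_1z_2,z_2^2,\ z_1^3,\sqrt3z_1^2z_2,\sqrt3z_1z_2^2,z_2^3$, a basis of the space $\mathcal W$ of polynomials in $z_1,z_2$ of degree at most three with zero constant term. $\mathbb B^n$ is the open unit ball of $\mathbb C^n$. A sphere map is a rational map $P/g$, holomorphic on $\mathbb B^2$, with $P=(p_1,\dots,p_N)^t$ a polynomial map and $\|P\|^2=|g|^2$ on $\partial\mathbb B^2$; it is normalized if $P(0)=0$ and $g(0)=1$, and has full rank if $p_1,\dots,p_N$ span $\mathcal W$. *)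

theory Defs
  imports "HOL-Analysis.Analysis"
begin

definition conj_transpose :: "complex^'n^'m \<Rightarrow> complex^'m^'n" where
  "conj_transpose A = (\<chi> i j. cnj (A $ j $ i))"

definition hermitian :: "complex^'n^'n \<Rightarrow> bool" where
  "hermitian H \<longleftrightarrow> conj_transpose H = H"

text \<open>The scalar $v^* H v$.\<close>

definition herm_form :: "complex^'n^'n \<Rightarrow> complex^'n \<Rightarrow> complex" where
  "herm_form H v = (\<Sum>i\<in>UNIV. cnj (v $ i) * (H *v v) $ i)"

definition pos_def :: "complex^'n^'n \<Rightarrow> bool" where
  "pos_def H \<longleftrightarrow> hermitian H \<and> (\<forall>v. v \<noteq> 0 \<longrightarrow> 0 < Re (herm_form H v))"

definition unitary :: "complex^'n^'n \<Rightarrow> bool" where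
  "unitary U \<longleftrightarrow> conj_transpose U ** U = mat 1 \<and> U ** conj_transpose U = mat 1"

text \<open>Polynomials in $z_1, z_2$ are identified with the functions they define on
  \<^typ>\<open>complex^2\<close>; over the complex numbers this loses nothing.\<close>

definition polys_deg_le :: "nat \<Rightarrow> (complex^2 \<Rightarrow> complex) set" where
  "polys_deg_le d =
    {p. \<exists>c :: nat \<Rightarrow> nat \<Rightarrow> complex.
          \<forall>z. p z = (\<Sum>(i, j) \<in> {(i, j). i + j \<le> d}. c i j * (z $ 1) ^ i * (z $ 2) ^ j)}"

definition polys :: "(complex^2 \<Rightarrow> complex) set" where
  "polys = (\<Union>d. polys_deg_le d)"

definition poly_space_W :: "(complex^2 \<Rightarrow> complex) set" where
  "poly_space_W = {p \<in> polys_deg_le 3. p 0 = 0}"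

definition V :: "complex^2 \<Rightarrow> complex^9" where
  "V z = vector
    [z $ 1, z $ 2,
     (z $ 1)\<^sup>2, of_real (sqrt 2) * z $ 1 * z $ 2, (z $ 2)\<^sup>2,
     (z $ 1) ^ 3, of_real (sqrt 3) * (z $ 1)\<^sup>2 * z $ 2,
     of_real (sqrt 3) * z $ 1 * (z $ 2)\<^sup>2, (z $ 2) ^ 3]"

text \<open>Holomorphy of a vector-valued map on an open set of $\mathbf{C}^m$: the Frechet derivative
  exists at every point and is complex linear.\<close>

definition holomorphic_map_on :: "(complex^'m \<Rightarrow> complex^'n) \<Rightarrow> (complex^'m) set \<Rightarrow> bool" where
  "holomorphic_map_on F S \<longleftrightarrow>
    (\<forall>z\<in>S. \<exists>F'. (F has_derivative F') (at z) \<and> Vector_Spaces.linear (*s) (*s) F')"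

text \<open>A rational map \<open>P/g\<close> is given by its numerator and denominator. That it is holomorphic on
  the ball means that it agrees, off the zeros of \<open>g\<close>, with a holomorphic map.\<close>

definition sphere_map :: "(complex^2 \<Rightarrow> complex^'n) \<Rightarrow> (complex^2 \<Rightarrow> complex) \<Rightarrow> bool" where
  "sphere_map P g \<longleftrightarrow>
    (\<forall>k. (\<lambda>z. P z $ k) \<in> polys) \<and> g \<in> polys \<and> (\<exists>z. g z \<noteq> 0) \<and>
    (\<exists>F. holomorphic_map_on F (ball 0 1) \<and>
         (\<forall>z \<in> ball 0 1. g z \<noteq> 0 \<longrightarrow> F z = inverse (g z) *s P z)) \<and>
    (\<forall>z \<in> sphere 0 1. (norm (P z))\<^sup>2 = (cmod (g z))\<^sup>2)"

definition normalized :: "(complex^2 \<Rightarrow> complex^'n) \<Rightarrow> (complex^2 \<Rightarrow> complex) \<Rightarrow> bool" where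
  "normalized P g \<longleftrightarrow> P 0 = 0 \<and> g 0 = 1"

text \<open>The left-hand side is the complex linear span of the components of \<open>P\<close>.\<close>

definition full_rank :: "(complex^2 \<Rightarrow> complex^'n) \<Rightarrow> bool" where
  "full_rank P \<longleftrightarrow>
    range (\<lambda>a :: complex^'n. \<lambda>z. \<Sum>k\<in>UNIV. a $ k * P z $ k) = poly_space_W"

text \<open>The numerators of the normalized full-rank sphere maps \<open>P/g\<close> of numerator degree at most
  three, with target $\mathbf{C}^n$. As \<open>g\<close> is fixed, \<open>P\<close> and \<open>P/g\<close> determine each other.\<close>

definition full_rank_maps :: "(complex^2 \<Rightarrow> complex) \<Rightarrow> (complex^2 \<Rightarrow> complex^'n) set" where
  "full_rank_maps g =
    {P. sphere_map P g \<and> normalized P g \<and> (\<forall>k. (\<lambda>z. P z $ k) \<in> polys_deg_le 3) \<and> full_rank P}"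

definition unitary_equiv ::
    "(complex^2 \<Rightarrow> complex) \<Rightarrow> ((complex^2 \<Rightarrow> complex^'n) \<times> (complex^2 \<Rightarrow> complex^'n)) set" where
  "unitary_equiv g =
    {(P, Q). P \<in> full_rank_maps g \<and> Q \<in> full_rank_maps g \<and>
             (\<exists>U. unitary U \<and> Q = (\<lambda>z. U *v P z))}"

text \<open>The components of \<open>P\<close> are placed in the coordinates selected by an injection \<open>\<iota>\<close>, and the
  remaining coordinates are zero.\<close>

definition adjoin_zeros ::
    "('m \<Rightarrow> 'n) \<Rightarrow> (complex^2 \<Rightarrow> complex^'m) \<Rightarrow> complex^2 \<Rightarrow> complex^'n" where
  "adjoin_zeros \<iota> P =
    (\<lambda>z. \<chi> k. if k \<in> range \<iota> then P z $ (inv \<iota> k) else 0)"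

text \<open>\<open>C\<^sup>* C\<close> for the matrix \<open>C\<close> with \<open>P = C V\<close>, which is unique whenever it exists because the
  entries of \<open>V\<close> are linearly independent.\<close>

definition gram :: "(complex^2 \<Rightarrow> complex^'n) \<Rightarrow> complex^9^9" where
  "gram P = (let C = (THE C :: complex^9^'n. P = (\<lambda>z. C *v V z)) in conj_transpose C ** C)"

definition g_sigma :: "real \<Rightarrow> real \<Rightarrow> complex^2 \<Rightarrow> complex" where
  "g_sigma \<sigma>1 \<sigma>2 z = 1 + of_real \<sigma>1 * (z $ 1)\<^sup>2 + of_real \<sigma>2 * (z $ 2)\<^sup>2"

definition gram_space :: "(complex^2 \<Rightarrow> complex) \<Rightarrow> (complex^9^9) set" where
  "gram_space g =
    {H. hermitian H \<and> (\<forall>z \<in> sphere 0 1. herm_form H (V z) = of_real ((cmod (g z))\<^sup>2))}"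

definition full_rank_spectrahedron :: "(complex^2 \<Rightarrow> complex) \<Rightarrow> (complex^9^9) set" where
  "full_rank_spectrahedron g = {H \<in> gram_space g. pos_def H}"

end

theory Submission
  imports Defs "HOL-Complex_Analysis.Conformal_Mappings"
begin

text \<open>
A numerator of degree at most three without constant term is $P = C\mathbf V$ for a unique
  matrix $C$, because the entries of $\mathbf V$ form a basis of $\mathcal W$
  (\<open>V_independent\<close>, \<open>linear_in_V\<close>). Since
  $\|P\|^2 = \mathbf V^* (C^* C) \mathbf V$, the sphere condition on $P$ is an affine condition on
  the Gram matrix $H = C^* C$, and full rank of $P$ says that $C$ has a left inverse, that is,
  $H > 0$ (\<open>linear_V_full_rank_maps_iff\<close>). Conversely $H$ determines $C$ up to a unitary factor on the
  left: matrices with the same Gram matrix differ by such a factor (\<open>gram_eq_imp_unitary\<close>), and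
  every positive definite $H$ has a Cholesky factor, which zero rows pad to any target
  of dimension at least nine (\<open>full_rank_spectrahedron_factors\<close>). Stability is the same argument:
  a map into the larger space has a Gram matrix, and a square factor of that matrix is a map
  into $\mathbf C^9$.

  Dimension. Two points of $\mathcal A_g$ differ by a Hermitian form in $\mathbf V$ that vanishes
  on the sphere. Its parts of bidegree $(a,b)$ are separated by the circle action and by
  homogeneity, and the resulting relations say that the form is $(1 - \|z\|^2)\,q$, where
  $q$ is a Hermitian form in the monomials of degree one and two
  (\<open>vanishing_on_sphere_divisible\<close>). There are five such monomials, and $q$ is
  arbitrary, so the dimension is that of the Hermitian $5 \times 5$ matrices, which is 25.

  Nonemptiness. Both $|g|^2$ and the sphere are invariant under sign changes of the coordinates, so
  it is natural to look for $H$ with the same symmetry; it then splits into small blocks. If the two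
  entries of degree one are $1 - \epsilon s$ and $1 - \epsilon t$ with $s = \sqrt{1 - \sigma_1^2}$,
  $t = \sqrt{1 - \sigma_2^2}$ and small $\epsilon$, positivity of the two $3 \times 3$ blocks reduces
  to $(s+t)^2 > 1$
  (\<open>pos_def_parity_gram\<close>). Openness holds because positivity is tested on the compact unit sphere.

  That $P/g$ maps the ball into itself is the maximum principle on the disc through the origin and
  the given point (\<open>linear_V_maps_into_ball\<close>); it uses that $g$ has no zero on the closed ball.
\<close>

section \<open>Hermitian forms\<close>

definition cinner :: "complex^'n \<Rightarrow> complex^'n \<Rightarrow> complex" where
  "cinner v w = (\<Sum>i\<in>UNIV. cnj (v $ i) * w $ i)"

lemma cinner_add_left: "cinner (u + v) w = cinner u w + cinner v w"
  by (simp add: cinner_def sum.distrib algebra_simps)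

lemma cinner_add_right: "cinner u (v + w) = cinner u v + cinner u w"
  by (simp add: cinner_def sum.distrib algebra_simps)

lemma cinner_diff_left: "cinner (u - v) w = cinner u w - cinner v w"
  by (simp add: cinner_def sum_subtractf algebra_simps)

lemma cinner_diff_right: "cinner u (v - w) = cinner u v - cinner u w"
  by (simp add: cinner_def sum_subtractf algebra_simps)

lemma cinner_scale_left: "cinner (c *s v) w = cnj c * cinner v w"
  by (simp add: cinner_def sum_distrib_left algebra_simps)

lemma cinner_scale_right: "cinner v (c *s w) = c * cinner v w"
  by (simp add: cinner_def sum_distrib_left algebra_simps)

lemma cinner_commute: "cnj (cinner v w) = cinner w v"
  by (simp add: cinner_def mult.commute)

lemma norm_sq_vec: "(norm (v :: complex^'n))\<^sup>2 = (\<Sum>i\<in>UNIV. (cmod (v $ i))\<^sup>2)"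
  by (simp add: norm_vec_def L2_set_def sum_nonneg)

lemma cinner_self: "cinner v v = of_real ((norm v)\<^sup>2)"
  by (simp add: cinner_def norm_sq_vec complex_norm_square mult.commute del: of_real_power)

lemma norm_cinner_le: "cmod (cinner v w) \<le> norm v * norm w"
proof -
  have "cmod (cinner v w) \<le> (\<Sum>i\<in>UNIV. \<bar>cmod (v $ i)\<bar> * \<bar>cmod (w $ i)\<bar>)"
    unfolding cinner_def by (rule sum_norm_le) (simp add: norm_mult)
  also have "\<dots> \<le> norm v * norm w"
    unfolding norm_vec_def by (rule L2_set_mult_ineq)
  finally show ?thesis .
qed

lemma conj_transpose_nth [simp]: "conj_transpose A $ i $ j = cnj (A $ j $ i)"
  by (simp add: conj_transpose_def)

lemma cinner_adjoint: "cinner v (A *v w) = cinner (conj_transpose A *v v) w"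
  unfolding cinner_def matrix_vector_mult_def
  by (simp add: sum_distrib_left sum_distrib_right mult_ac)
     (rule sum.swap)

lemma conj_transpose_mult: "conj_transpose (A ** B) = conj_transpose B ** conj_transpose A"
  by (simp add: conj_transpose_def matrix_matrix_mult_def vec_eq_iff mult.commute)

lemma conj_transpose_conj_transpose [simp]: "conj_transpose (conj_transpose A) = A"
  by (simp add: conj_transpose_def vec_eq_iff)

lemma conj_transpose_mat_1 [simp]: "conj_transpose (mat 1) = mat 1"
  by (auto simp add: conj_transpose_def mat_def vec_eq_iff)

lemma herm_form_cinner: "herm_form H v = cinner v (H *v v)"
  by (simp add: herm_form_def cinner_def)

lemma herm_form_conjugate: "herm_form (conj_transpose A ** H ** A) v = herm_form H (A *v v)"
  by (simp add: herm_form_cinner cinner_adjoint flip: matrix_vector_mul_assoc)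

lemma herm_form_gram: "herm_form (conj_transpose C ** C) v = of_real ((norm (C *v v))\<^sup>2)"
  by (metis cinner_adjoint cinner_self conj_transpose_conj_transpose herm_form_cinner
      matrix_vector_mul_assoc)

lemma hermitian_conjugate: "hermitian H \<Longrightarrow> hermitian (conj_transpose A ** H ** A)"
  by (simp add: hermitian_def conj_transpose_mult matrix_mul_assoc)

lemma hermitian_gram: "hermitian (conj_transpose C ** C)"
  by (simp add: hermitian_def conj_transpose_mult)

text \<open>The form of $C^* C$ is $v \mapsto \|Cv\|^2$, so it is positive exactly off the kernel of $C$.\<close>

lemma pos_def_gram_iff:
  fixes C :: "complex^'n^'m"
  shows "pos_def (conj_transpose C ** C) \<longleftrightarrow> inj ((*v) C)"
proof -
  have "pos_def (conj_transpose C ** C) \<longleftrightarrow> (\<forall>v. C *v v = 0 \<longrightarrow> v = 0)"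
    by (auto simp add: pos_def_def hermitian_gram herm_form_gram)
  then show ?thesis
    using matrix_left_invertible_injective[of C] matrix_left_invertible_ker[of C] by blast
qed

text \<open>Positivity need only be tested on unit vectors. The projection of a closed set along the compact
  unit sphere is closed, so the matrices that fail the test form a closed set.\<close>

lemma pos_def_relatively_open:
  "\<exists>U :: (complex^'n^'n) set. open U \<and> (\<forall>H. pos_def H \<longleftrightarrow> hermitian H \<and> H \<in> U)"
proof -
  define T where "T = {(v :: complex^'n, H :: complex^'n^'n). Re (herm_form H v) \<le> 0}"
  have "closed T"
    unfolding T_def case_prod_unfold herm_form_def matrix_vector_mult_def
    by (intro closed_Collect_le continuous_intros)
  then have cl: "closed {H. \<exists>v. v \<in> sphere 0 1 \<and> (v, H) \<in> T}"
    by (intro closed_compact_projection) auto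
  have *: "(\<forall>v. v \<noteq> 0 \<longrightarrow> 0 < Re (herm_form H v)) \<longleftrightarrow>
      H \<in> - {H. \<exists>v. v \<in> sphere 0 1 \<and> (v, H) \<in> T}" (is "?L \<longleftrightarrow> ?R") for H
  proof
    assume R: ?R
    show ?L
    proof (intro allI impI)
      fix v :: "complex^'n" assume "v \<noteq> 0"
      define w where "w = of_real (inverse (norm v)) *s v"
      have w': "w = inverse (norm v) *\<^sub>R v"
        by (simp add: w_def vec_eq_iff scaleR_conv_of_real[where 'a = complex])
      have "norm w = 1" using \<open>v \<noteq> 0\<close> by (simp add: w')
      then have "0 < Re (herm_form H w)" using R by (auto simp: T_def not_le)
      moreover have "herm_form H w = of_real (inverse (norm v) ^ 2) * herm_form H v"
        by (simp add: w_def herm_form_cinner vector_scalar_commute cinner_scale_left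
            cinner_scale_right power2_eq_square)
      ultimately have "0 < inverse (norm v) ^ 2 * Re (herm_form H v)"
        by (simp del: of_real_power)
      then show "0 < Re (herm_form H v)" by (simp add: zero_less_mult_iff)
    qed
  next
    assume L: ?L
    have "v \<noteq> 0" if "norm v = 1" for v :: "complex^'n" using that by auto
    with L show ?R by (auto simp: T_def not_le)
  qed
  show ?thesis
    by (rule exI[of _ "- {H. \<exists>v. v \<in> sphere 0 1 \<and> (v, H) \<in> T}"])
       (use cl * in \<open>auto simp only: pos_def_def open_Compl\<close>)
qed

section \<open>Extending isometries to unitary matrices\<close>

lemma unitary_mult: "unitary A \<Longrightarrow> unitary B \<Longrightarrow> unitary (A ** B)"
  unfolding unitary_def conj_transpose_mult
  by (metis (no_types, lifting) matrix_mul_assoc matrix_mul_lid)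

lemma unitary_mat_1: "unitary (mat 1)"
  by (simp add: unitary_def)

lemma unitary_cinner: "unitary U \<Longrightarrow> cinner (U *v v) (U *v w) = cinner v w"
  by (simp add: cinner_adjoint matrix_vector_mul_assoc unitary_def)

lemma unitaryI: "conj_transpose U ** U = mat 1 \<Longrightarrow> unitary U"
  by (simp add: unitary_def matrix_left_right_inverse)

text \<open>The complex Householder reflection. With $w = c - d$ the map
  $x \mapsto x - (w^* x / w^* c)\,w$ sends $c$ to $d$ and fixes every $x$ orthogonal to $w$. It is
  unitary because $\|c\| = \|d\|$ gives $w^* w = 2\,\mathrm{Re}(w^* c)$.\<close>

lemma unitary_reflection:
  fixes c d :: "complex^'n"
  assumes "cinner c c = cinner d d"
  shows "\<exists>R. unitary R \<and> R *v c = d \<and>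
    (\<forall>x. cinner x c = cinner x d \<longrightarrow> R *v x = x)"
proof (cases "c = d")
  case True
  then show ?thesis using unitary_mat_1 by (intro exI[of _ "mat 1"]) auto
next
  case False
  define w where "w = c - d"
  define m where "m = cinner w c"
  have m2: "cinner w w = m + cnj m"
    unfolding m_def cinner_commute w_def
    using assms by (simp add: cinner_diff_left cinner_diff_right)
  have "cinner w w \<noteq> 0" using False by (simp add: cinner_self w_def)
  then have "m \<noteq> 0" using m2 by auto
  define R :: "complex^'n^'n" where "R = (\<chi> i j. (if i = j then 1 else 0) - w $ i * cnj (w $ j) / m)"
  have Rx: "R *v x = x - (cinner w x / m) *s w" for x
    by (simp add: R_def matrix_vector_mult_def vec_eq_iff cinner_def left_diff_distrib
        sum_subtractf if_distrib[of "\<lambda>a. a * _"] cong: if_cong)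
       (simp add: sum_distrib_left sum_divide_distrib mult_ac)
  have Rsx: "conj_transpose R *v x = x - (cinner w x / cnj m) *s w" for x
    by (simp add: R_def matrix_vector_mult_def vec_eq_iff cinner_def left_diff_distrib
        sum_subtractf if_distrib[of "\<lambda>a. a * _"] if_distrib[of cnj] cong: if_cong)
       (simp add: sum_distrib_left sum_divide_distrib mult_ac)
  have "conj_transpose R *v (R *v x) = x" for x
  proof -
    have "cinner w x / m + (cinner w x - cinner w x / m * (m + cnj m)) / cnj m = 0"
      using \<open>m \<noteq> 0\<close> by (simp add: field_simps)
    moreover have "conj_transpose R *v (R *v x) =
      x - (cinner w x / m + (cinner w x - cinner w x / m * (m + cnj m)) / cnj m) *s w"
      unfolding Rsx Rx cinner_diff_right cinner_scale_right m2
      by (simp add: vec_eq_iff algebra_simps)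
    ultimately show ?thesis by simp
  qed
  then have "conj_transpose R ** R = mat 1"
    by (simp add: matrix_eq flip: matrix_vector_mul_assoc)
  then have "unitary R" by (rule unitaryI)
  moreover have "R *v c = d"
    using \<open>m \<noteq> 0\<close> by (simp add: Rx flip: m_def) (simp add: w_def)
  moreover have "R *v x = x" if "cinner x c = cinner x d" for x
  proof -
    have "cinner x w = 0" by (simp add: w_def cinner_diff_right that)
    then have "cinner w x = 0" by (metis cinner_commute complex_cnj_zero)
    then show ?thesis by (simp add: Rx)
  qed
  ultimately show ?thesis by blast
qed

text \<open>The vectors are moved to their targets one at a time. Equality of the inner products puts the
  targets already reached among the vectors that the next reflection fixes.\<close>

lemma unitary_extension:
  fixes c d :: "'k \<Rightarrow> complex^'n"
  assumes "finite S" and "\<And>i j. i \<in> S \<Longrightarrow> j \<in> S \<Longrightarrow> cinner (c i) (c j) = cinner (d i) (d j)"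
  shows "\<exists>U. unitary U \<and> (\<forall>i\<in>S. U *v c i = d i)"
  using assms
proof (induction S)
  case empty
  then show ?case using unitary_mat_1 by blast
next
  case (insert k S)
  then obtain U where U: "unitary U" "\<And>i. i \<in> S \<Longrightarrow> U *v c i = d i" by auto
  have "cinner (U *v c k) (U *v c k) = cinner (d k) (d k)"
    using insert.prems U(1) by (simp add: unitary_cinner)
  from unitary_reflection[OF this] obtain R where R: "unitary R" "R *v (U *v c k) = d k"
    "\<And>x. cinner x (U *v c k) = cinner x (d k) \<Longrightarrow> R *v x = x" by blast
  have "R *v (U *v c i) = d i" if "i \<in> S" for i
  proof -
    have "cinner (d i) (U *v c k) = cinner (d i) (d k)"
      using U that insert.prems[of i k] by (metis insertI1 insertI2 unitary_cinner)
    then show ?thesis using R(3) U(2) that by simp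
  qed
  then show ?case
    using R U by (intro exI[of _ "R ** U"])
      (auto simp: unitary_mult simp flip: matrix_vector_mul_assoc)
qed

lemma matrix_mult_column: "(A ** B) $ i $ j = (A *v column j B) $ i"
  by (simp add: matrix_matrix_mult_def matrix_vector_mult_def column_def)

lemma gram_nth: "(conj_transpose C ** C) $ i $ j = cinner (column i C) (column j C)"
  by (simp add: cinner_def matrix_matrix_mult_def column_def)

lemma gram_eq_imp_unitary:
  fixes C D :: "complex^'k^'n"
  assumes "conj_transpose C ** C = conj_transpose D ** D"
  shows "\<exists>U. unitary U \<and> D = U ** C"
proof -
  have "\<exists>U. unitary U \<and> (\<forall>i\<in>UNIV. U *v column i C = column i D)"
    using assms by (intro unitary_extension) (simp_all flip: gram_nth)
  then obtain U where "unitary U" "\<And>i. U *v column i C = column i D" by blast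
  then have "D = U ** C"
    by (simp add: vec_eq_iff matrix_mult_column) (simp add: column_def)
  with \<open>unitary U\<close> show ?thesis by blast
qed

section \<open>Cholesky factorization\<close>

lemma herm_form_double_sum:
  "herm_form H v = (\<Sum>i\<in>UNIV. \<Sum>j\<in>UNIV. H $ i $ j * (cnj (v $ i) * v $ j))"
  by (simp add: herm_form_def matrix_vector_mult_def sum_distrib_left mult_ac)

text \<open>Cholesky's recursion, for a matrix supported on the rows and columns in \<open>S\<close>. The Schur complement
  of a diagonal entry is again positive: its form at $v$ is the minimum over $t$ of the form of
  \<open>H\<close> at $v + t e_k$.\<close>

lemma cholesky_supported:
  fixes H :: "complex^'n^'n"
  assumes "finite S" "hermitian H"
    and "\<And>i j. i \<notin> S \<Longrightarrow> H $ i $ j = 0"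
    and "\<And>v. v \<noteq> 0 \<Longrightarrow> (\<And>i. i \<notin> S \<Longrightarrow> v $ i = 0) \<Longrightarrow> 0 < Re (herm_form H v)"
  shows "\<exists>B :: complex^'n^'n. (\<forall>i j. i \<notin> S \<longrightarrow> B $ i $ j = 0) \<and> conj_transpose B ** B = H"
  using assms
proof (induction S arbitrary: H)
  case empty
  then have "H = 0" by (simp add: vec_eq_iff)
  then show ?case
    by (intro exI[of _ 0]) (simp add: conj_transpose_def matrix_matrix_mult_def vec_eq_iff)
next
  case (insert k S)
  have herm: "cnj (H $ j $ i) = H $ i $ j" for i j
    using insert.prems(1) by (metis conj_transpose_nth hermitian_def)
  define h where "h = Re (H $ k $ k)"
  have Hkk: "H $ k $ k = of_real h"
    using herm[of k k] by (simp add: h_def complex_eq_iff)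
  have "herm_form H (axis k 1) = H $ k $ k"
    by (simp add: herm_form_double_sum axis_def if_distrib[of "\<lambda>a. a * _"]
        if_distrib[of "\<lambda>a. _ * a"] if_distrib[of cnj] cong: if_cong)
  moreover have "0 < Re (herm_form H (axis k 1))"
    by (rule insert.prems) (auto simp: axis_def vec_eq_iff)
  ultimately have h: "0 < h" by (simp add: h_def)
  define H' :: "complex^'n^'n" where
    "H' = (\<chi> i j. H $ i $ j - cnj (H $ k $ i) * H $ k $ j / of_real h)"
  have H'_form: "herm_form H' v =
      herm_form H v - cnj ((H *v v) $ k) * (H *v v) $ k / of_real h" for v
  proof -
    have "cnj ((H *v v) $ k) * (H *v v) $ k / of_real h =
      (\<Sum>i\<in>UNIV. \<Sum>j\<in>UNIV. (cnj (H $ k $ i) * H $ k $ j / of_real h) * (cnj (v $ i) * v $ j))"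
      by (simp add: matrix_vector_mult_def sum_product sum_divide_distrib mult_ac)
         (rule sum.swap)
    then show ?thesis
      by (simp add: herm_form_double_sum H'_def left_diff_distrib sum_subtractf)
  qed
  have "\<exists>B :: complex^'n^'n. (\<forall>i j. i \<notin> S \<longrightarrow> B $ i $ j = 0) \<and> conj_transpose B ** B = H'"
  proof (rule insert.IH)
    show "hermitian H'"
      by (simp add: hermitian_def vec_eq_iff H'_def herm mult.commute)
    show "H' $ i $ j = 0" if "i \<notin> S" for i j
    proof (cases "i = k")
      case True
      then show ?thesis using h by (simp add: H'_def herm Hkk)
    next
      case False
      then have "H $ i $ j = 0" "H $ i $ k = 0" using that insert.prems(2) by auto
      then show ?thesis by (simp add: H'_def herm)
    qed
  next
    fix v :: "complex^'n"
    assume v: "v \<noteq> 0" "\<And>i. i \<notin> S \<Longrightarrow> v $ i = 0"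
    \<comment> \<open>The minimizer of the form on the line $v + t e_k$.\<close>
    define t where "t = - (H *v v) $ k / of_real h"
    define u where "u = v + t *s axis k 1"
    have Ha: "(H *v axis k 1) $ i = H $ i $ k" for i
      by (simp add: matrix_vector_mult_def axis_def if_distrib[of "\<lambda>a. _ * a"] cong: if_cong)
    have c1: "cinner (axis k 1) x = x $ k" for x :: "complex^'n"
      by (simp add: cinner_def axis_def if_distrib[of "\<lambda>a. a * _"] if_distrib[of cnj] cong: if_cong)
    have c2: "cinner v (H *v axis k 1) = cnj ((H *v v) $ k)"
      by (simp add: cinner_def Ha) (simp add: matrix_vector_mult_def herm mult.commute)
    have "herm_form H u = herm_form H v + t * cnj ((H *v v) $ k) + cnj t * (H *v v) $ k
        + cnj t * t * of_real h"
      by (simp add: u_def herm_form_cinner matrix_vector_right_distrib vector_scalar_commute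
          cinner_add_left cinner_add_right cinner_scale_left cinner_scale_right c1 c2 Ha Hkk
          algebra_simps)
    also have "\<dots> = herm_form H' v"
      using h by (simp add: H'_form t_def field_simps)
    finally have "herm_form H' v = herm_form H u" ..
    moreover have "0 < Re (herm_form H u)"
    proof (rule insert.prems)
      obtain i where i: "v $ i \<noteq> 0" using v(1) by (auto simp: vec_eq_iff)
      then have "i \<noteq> k" using v(2) insert.hyps by auto
      with i have "u $ i \<noteq> 0" by (simp add: u_def axis_def)
      then show "u \<noteq> 0" by auto
      show "u $ i = 0" if "i \<notin> insert k S" for i
        using that v(2) by (simp add: u_def axis_def)
    qed
    ultimately show "0 < Re (herm_form H' v)" by simp
  qed
  then obtain B where B: "\<And>i j. i \<notin> S \<Longrightarrow> B $ i $ j = 0" "conj_transpose B ** B = H'" by blast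
  define B' :: "complex^'n^'n" where
    "B' = (\<chi> i j. if i = k then H $ k $ j / of_real (sqrt h) else B $ i $ j)"
  have "(conj_transpose B' ** B') $ i $ j = H $ i $ j" for i j
  proof -
    have "(conj_transpose B' ** B') $ i $ j =
      cnj (H $ k $ i / of_real (sqrt h)) * (H $ k $ j / of_real (sqrt h))
      + (\<Sum>l\<in>UNIV - {k}. cnj (B $ l $ i) * B $ l $ j)"
      by (simp add: matrix_matrix_mult_def sum.remove[of UNIV k] B'_def)
    also have "(\<Sum>l\<in>UNIV - {k}. cnj (B $ l $ i) * B $ l $ j) = H' $ i $ j"
      using B(1)[OF insert.hyps(2)] unfolding B(2)[symmetric]
      by (simp add: matrix_matrix_mult_def sum.remove[of UNIV k])
    also have "cnj (H $ k $ i / of_real (sqrt h)) * (H $ k $ j / of_real (sqrt h)) =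
        cnj (H $ k $ i) * H $ k $ j / of_real h"
      using h by (simp flip: of_real_mult)
    finally show ?thesis by (simp add: H'_def)
  qed
  then have "conj_transpose B' ** B' = H" by (simp add: vec_eq_iff)
  moreover have "\<forall>i j. i \<notin> insert k S \<longrightarrow> B' $ i $ j = 0" by (simp add: B'_def B(1))
  ultimately show ?case by blast
qed

lemma pos_def_cholesky:
  fixes H :: "complex^'n^'n"
  assumes "pos_def H"
  shows "\<exists>B :: complex^'n^'n. conj_transpose B ** B = H"
  using cholesky_supported[of UNIV H] assms by (auto simp: pos_def_def)

section \<open>Linear independence of products of monomials\<close>

lemma exhaust_9: "(x::9) = 1 \<or> x = 2 \<or> x = 3 \<or> x = 4 \<or> x = 5 \<or> x = 6 \<or> x = 7 \<or> x = 8 \<or> x = 9"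
proof (induct x)
  case (of_int z)
  then have "z = 0 \<or> z = 1 \<or> z = 2 \<or> z = 3 \<or> z = 4 \<or> z = 5 \<or> z = 6 \<or> z = 7 \<or> z = 8" by fastforce
  then show ?case by auto
qed

lemma exhaust_5: "(x::5) = 1 \<or> x = 2 \<or> x = 3 \<or> x = 4 \<or> x = 5"
proof (induct x)
  case (of_int z)
  then have "z = 0 \<or> z = 1 \<or> z = 2 \<or> z = 3 \<or> z = 4" by fastforce
  then show ?case by auto
qed

lemma forall_9: "(\<forall>i::9. P i) \<longleftrightarrow> P 1 \<and> P 2 \<and> P 3 \<and> P 4 \<and> P 5 \<and> P 6 \<and> P 7 \<and> P 8 \<and> P 9"
  by (metis exhaust_9)

lemma forall_5: "(\<forall>i::5. P i) \<longleftrightarrow> P 1 \<and> P 2 \<and> P 3 \<and> P 4 \<and> P 5"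
  by (metis exhaust_5)

lemma UNIV_9: "(UNIV :: 9 set) = {1, 2, 3, 4, 5, 6, 7, 8, 9}"
  using exhaust_9 by auto

lemma UNIV_5: "(UNIV :: 5 set) = {1, 2, 3, 4, 5}"
  using exhaust_5 by auto

lemma sum_9: "sum f (UNIV :: 9 set) = f 1 + f 2 + f 3 + f 4 + f 5 + f 6 + f 7 + f 8 + f 9"
  unfolding UNIV_9 by (simp add: add.assoc)

lemma sum_5: "sum f (UNIV :: 5 set) = f 1 + f 2 + f 3 + f 4 + f 5"
  unfolding UNIV_5 by (simp add: add.assoc)

lemma vector_9 [simp]:
  "(vector [a,b,c,d,e,f,g,h,k] :: 'a::zero^9) $ 1 = a"
  "(vector [a,b,c,d,e,f,g,h,k] :: 'a::zero^9) $ 2 = b"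
  "(vector [a,b,c,d,e,f,g,h,k] :: 'a::zero^9) $ 3 = c"
  "(vector [a,b,c,d,e,f,g,h,k] :: 'a::zero^9) $ 4 = d"
  "(vector [a,b,c,d,e,f,g,h,k] :: 'a::zero^9) $ 5 = e"
  "(vector [a,b,c,d,e,f,g,h,k] :: 'a::zero^9) $ 6 = f"
  "(vector [a,b,c,d,e,f,g,h,k] :: 'a::zero^9) $ 7 = g"
  "(vector [a,b,c,d,e,f,g,h,k] :: 'a::zero^9) $ 8 = h"
  "(vector [a,b,c,d,e,f,g,h,k] :: 'a::zero^9) $ 9 = k"
  unfolding vector_def by simp_all

lemma vector_5 [simp]:
  "(vector [a,b,c,d,e] :: 'a::zero^5) $ 1 = a"
  "(vector [a,b,c,d,e] :: 'a::zero^5) $ 2 = b"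
  "(vector [a,b,c,d,e] :: 'a::zero^5) $ 3 = c"
  "(vector [a,b,c,d,e] :: 'a::zero^5) $ 4 = d"
  "(vector [a,b,c,d,e] :: 'a::zero^5) $ 5 = e"
  unfolding vector_def by simp_all

definition exponent1 :: "9 \<Rightarrow> nat" where "exponent1 i = (vector [1,0,2,1,0,3,2,1,0] :: nat^9) $ i"
definition exponent2 :: "9 \<Rightarrow> nat" where "exponent2 i = (vector [0,1,0,1,2,0,1,2,3] :: nat^9) $ i"
definition mdeg :: "9 \<Rightarrow> nat" where "mdeg i = exponent1 i + exponent2 i"

text \<open>With these weights the squares of the moduli of the entries of degree $d$ add up to
  $\|z\|^{2d}$.\<close>

definition weight :: "9 \<Rightarrow> real" where "weight i = sqrt (real (mdeg i choose exponent1 i))"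

lemma V_nth: "V z $ i = of_real (weight i) * (z $ 1) ^ exponent1 i * (z $ 2) ^ exponent2 i"
proof -
  have "\<forall>i. V z $ i = of_real (weight i) * (z $ 1) ^ exponent1 i * (z $ 2) ^ exponent2 i"
    unfolding forall_9 by (simp add: V_def weight_def mdeg_def exponent1_def exponent2_def numeral_eq_Suc)
  then show ?thesis ..
qed

lemma weight_pos: "weight i > 0"
  by (simp add: weight_def mdeg_def)

lemma weight_nonzero [simp]: "weight i \<noteq> 0"
  using weight_pos[of i] by simp

lemma mdeg_cases: "mdeg i = 1 \<or> mdeg i = 2 \<or> mdeg i = 3"
proof -
  have "\<forall>i. mdeg i = 1 \<or> mdeg i = 2 \<or> mdeg i = 3"
    unfolding forall_9 by (simp add: mdeg_def exponent1_def exponent2_def)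
  then show ?thesis ..
qed

lemma exponents_inj: "exponent1 i = exponent1 j \<Longrightarrow> exponent2 i = exponent2 j \<Longrightarrow> i = j"
proof -
  have "\<forall>i j. exponent1 i = exponent1 j \<longrightarrow> exponent2 i = exponent2 j \<longrightarrow> i = j"
    unfolding forall_9 by (simp add: exponent1_def exponent2_def)
  then show "exponent1 i = exponent1 j \<Longrightarrow> exponent2 i = exponent2 j \<Longrightarrow> i = j" by blast
qed

lemma V_scale: "V (c *s z) $ i = c ^ mdeg i * V z $ i"
  by (simp add: V_nth mdeg_def power_mult_distrib power_add)

lemma V_0 [simp]: "V 0 = 0"
proof -
  have "\<forall>i. V 0 $ i = 0" unfolding forall_9 by (simp add: V_def)
  then show ?thesis by (simp add: vec_eq_iff)
qed

text \<open>Dedekind's theorem on the independence of characters. Replacing $x$ by $m\,y\,x$ in a relation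
  and subtracting $\varphi_k(y)$ times the relation removes the term with index $k$.\<close>

lemma multiplicative_functions_independent:
  fixes \<phi> :: "'i \<Rightarrow> 'm \<Rightarrow> 'a::field"
  assumes "finite I"
    and mult: "\<And>i x y. i \<in> I \<Longrightarrow> \<phi> i (m x y) = \<phi> i x * \<phi> i y"
    and nonzero: "\<And>i. i \<in> I \<Longrightarrow> \<exists>x. \<phi> i x \<noteq> 0"
    and distinct: "\<And>i j. i \<in> I \<Longrightarrow> j \<in> I \<Longrightarrow> i \<noteq> j \<Longrightarrow> \<exists>x. \<phi> i x \<noteq> \<phi> j x"
    and "\<And>x. (\<Sum>i\<in>I. c i * \<phi> i x) = 0"
  shows "\<forall>i\<in>I. c i = 0"
  using assms
proof (induction I arbitrary: c)
  case empty
  then show ?case by simp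
next
  case (insert k I)
  have zero: "c k * \<phi> k x + (\<Sum>i\<in>I. c i * \<phi> i x) = 0" for x
    using insert.prems(4)[of x] insert.hyps by simp
  have "c i = 0" if i: "i \<in> I" for i
  proof -
    obtain y where y: "\<phi> i y \<noteq> \<phi> k y"
      using insert.prems(3)[of i k] insert.hyps i by auto
    have "(\<Sum>j\<in>I. (c j * (\<phi> j y - \<phi> k y)) * \<phi> j x) = 0" for x
    proof -
      have "(\<Sum>j\<in>I. (c j * (\<phi> j y - \<phi> k y)) * \<phi> j x) =
          (\<Sum>j\<in>I. c j * \<phi> j (m y x)) - \<phi> k y * (\<Sum>j\<in>I. c j * \<phi> j x)"
        by (simp add: insert.prems(1) sum_subtractf sum_distrib_left algebra_simps cong: sum.cong)
      also have "\<dots> = 0"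
        using zero[of "m y x"] zero[of x] insert.prems(1)[of k]
        by (simp add: add_eq_0_iff algebra_simps)
      finally show ?thesis .
    qed
    then have "\<forall>j\<in>I. c j * (\<phi> j y - \<phi> k y) = 0"
      by (intro insert.IH) (use insert.prems in auto)
    with i y show ?thesis by auto
  qed
  moreover have "c k = 0"
    using insert.prems(2)[of k] zero calculation by auto
  ultimately show ?case by simp
qed

text \<open>The value at $2$ determines the sum of the exponents, and the values on the unit circle determine
  their difference.\<close>

lemma monomial_exponents_eq:
  assumes "\<And>z :: complex. cnj z ^ a * z ^ b = cnj z ^ c * z ^ d"
  shows "a = c \<and> b = d"
proof -
  have "(2::complex) ^ (a + b) = 2 ^ (c + d)"
    using assms[of 2] by (simp add: power_add)
  then have "of_nat (2 ^ (a + b)) = (of_nat (2 ^ (c + d)) :: complex)" by simp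
  then have s: "a + b = c + d" unfolding of_nat_eq_iff by simp
  have "b + c = d + a"
  proof (rule ccontr)
    assume that: "b + c \<noteq> d + a"
    define m where "m = real (b + c) - real (d + a)"
    have m: "m \<noteq> 0" using that by (simp add: m_def del: of_nat_add)
    \<comment> \<open>At this angle the two sides of the hypothesis differ by the factor $-1$.\<close>
    define \<theta> where "\<theta> = pi / m"
    have "cis (real a * - \<theta> + real b * \<theta>) = cis (real c * - \<theta> + real d * \<theta>)"
      using assms[of "cis \<theta>"] by (simp only: cis_cnj Complex.DeMoivre cis_mult)
    then have "cis (real a * - \<theta> + real b * \<theta> + - (real c * - \<theta> + real d * \<theta>)) = 1"
      by (simp only: cis_mult[symmetric]) (simp add: cis_mult)
    moreover have "real a * - \<theta> + real b * \<theta> + - (real c * - \<theta> + real d * \<theta>) = m * \<theta>"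
      by (simp add: m_def algebra_simps)
    ultimately show False using m by (simp add: \<theta>_def)
  qed
  with s show ?thesis by simp
qed

text \<open>The products of a conjugated monomial and a monomial are distinct multiplicative functions on
  $\mathbf C^2$, hence linearly independent. A sesquilinear form is therefore determined by its
  values on a vector of monomials.\<close>

lemma monomial_products_independent:
  fixes M :: "complex^'k^'k" and a b :: "'k \<Rightarrow> nat" and w :: "'k \<Rightarrow> real"
  assumes inj: "\<And>i j. a i = a j \<Longrightarrow> b i = b j \<Longrightarrow> i = j"
    and w: "\<And>i. w i \<noteq> 0"
    and zero: "\<And>z :: complex^2. herm_form M (\<chi> i. of_real (w i) * (z $ 1) ^ a i * (z $ 2) ^ b i) = 0"
  shows "M = 0"
proof -
  define \<phi> :: "'k \<times> 'k \<Rightarrow> complex^2 \<Rightarrow> complex" where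
    "\<phi> = (\<lambda>(i, j) z. (cnj (z $ 1) ^ a i * (z $ 1) ^ a j) * (cnj (z $ 2) ^ b i * (z $ 2) ^ b j))"
  have "\<forall>p\<in>UNIV. (\<lambda>(i, j). M $ i $ j * of_real (w i * w j)) p = 0"
  proof (rule multiplicative_functions_independent[where \<phi> = \<phi> and m = "(*)"])
    show "\<phi> p (x * y) = \<phi> p x * \<phi> p y" for p x y
      by (simp add: \<phi>_def case_prod_unfold power_mult_distrib)
    show "\<exists>x. \<phi> p x \<noteq> 0" for p
      by (rule exI[of _ 1]) (simp add: \<phi>_def case_prod_unfold)
    show "\<exists>x. \<phi> p x \<noteq> \<phi> q x" if "p \<noteq> q" for p q
    proof (rule ccontr)
      assume "\<not> ?thesis"
      then have eq: "\<phi> p x = \<phi> q x" for x by blast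
      obtain i j k l where p: "p = (i, j)" and q: "q = (k, l)" by (cases p, cases q)
      have "a i = a k \<and> a j = a l"
        by (rule monomial_exponents_eq) (use eq[of "vector [_, 1]"] in \<open>simp add: \<phi>_def p q\<close>)
      moreover have "b i = b k \<and> b j = b l"
        by (rule monomial_exponents_eq) (use eq[of "vector [1, _]"] in \<open>simp add: \<phi>_def p q\<close>)
      ultimately have "p = q" by (simp add: p q inj)
      with that show False ..
    qed
    show "(\<Sum>p\<in>UNIV. (\<lambda>(i, j). M $ i $ j * of_real (w i * w j)) p * \<phi> p z) = 0" for z
      using zero[of z]
      by (simp add: herm_form_double_sum \<phi>_def sum.cartesian_product case_prod_unfold mult_ac
          flip: UNIV_Times_UNIV)
  qed auto
  then have "M $ i $ j * of_real (w i * w j) = 0" for i j by fastforce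
  then show ?thesis by (simp add: vec_eq_iff w)
qed

lemma V_products_independent: "M = 0" if "\<And>z. herm_form M (V z) = 0"
proof (rule monomial_products_independent[where a = exponent1 and b = exponent2 and w = weight])
  show "herm_form M (\<chi> i. of_real (weight i) * (z $ 1) ^ exponent1 i * (z $ 2) ^ exponent2 i) = 0" for z :: "complex^2"
    using that[of z] by (simp flip: V_nth)
qed (simp_all add: exponents_inj)

lemma V_independent:
  fixes A B :: "complex^9^'n"
  assumes "\<And>z. A *v V z = B *v V z"
  shows "A = B"
proof -
  have "conj_transpose (A - B) ** (A - B) = 0"
    by (rule V_products_independent)
       (simp add: herm_form_gram matrix_vector_mult_diff_rdistrib assms)
  then have "cinner (column j (A - B)) (column j (A - B)) = 0" for j
    by (metis gram_nth zero_index)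
  then have "column j (A - B) = 0" for j by (simp add: cinner_self)
  then show ?thesis by (simp add: vec_eq_iff column_def)
qed


lemma degree_le_3_indices:
  "{(i, j). i + j \<le> (3::nat)} = {(0,0),(1,0),(0,1),(2,0),(1,1),(0,2),(3,0),(2,1),(1,2),(0,3)}"
proof -
  have "{(i, j). i + j \<le> (3::nat)} = (SIGMA i:{..3}. {..3 - i})" by auto
  also have "\<dots> = {(0,0),(1,0),(0,1),(2,0),(1,1),(0,2),(3,0),(2,1),(1,2),(0,3)}"
    by (auto simp: Sigma_def atMost_nat_numeral atMost_Suc)
  finally show ?thesis .
qed

lemma poly_space_W_iff:
  "p \<in> poly_space_W \<longleftrightarrow> (\<exists>a :: complex^9. \<forall>z. p z = (\<Sum>i\<in>UNIV. a $ i * V z $ i))"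
proof
  assume "p \<in> poly_space_W"
  then obtain c where c: "\<And>z. p z = (\<Sum>(i, j) \<in> {(i, j). i + j \<le> 3}. c i j * (z $ 1) ^ i * (z $ 2) ^ j)"
    and "p 0 = 0" by (auto simp: poly_space_W_def polys_deg_le_def)
  then have c0: "c 0 0 = 0" using c[of 0] by (simp add: degree_le_3_indices)
  show "\<exists>a :: complex^9. \<forall>z. p z = (\<Sum>i\<in>UNIV. a $ i * V z $ i)"
  proof (intro exI allI)
    fix z
    show "p z = (\<Sum>i\<in>UNIV. (\<chi> i. c (exponent1 i) (exponent2 i) / of_real (weight i)) $ i * V z $ i)"
      by (simp only: c degree_le_3_indices)
        (simp add: c0 V_nth sum_9, simp add: exponent1_def exponent2_def)
  qed
next
  assume "\<exists>a :: complex^9. \<forall>z. p z = (\<Sum>i\<in>UNIV. a $ i * V z $ i)"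
  then obtain a :: "complex^9" where a: "\<And>z. p z = (\<Sum>i\<in>UNIV. a $ i * V z $ i)" by blast
  define c :: "nat \<Rightarrow> nat \<Rightarrow> complex" where
    "c i j = [[0, a $ 2, a $ 5, a $ 9],
              [a $ 1, of_real (sqrt 2) * a $ 4, of_real (sqrt 3) * a $ 8],
              [a $ 3, of_real (sqrt 3) * a $ 7],
              [a $ 6]] ! i ! j" for i j
  have "p z = (\<Sum>(i, j) \<in> {(i, j). i + j \<le> 3}. c i j * (z $ 1) ^ i * (z $ 2) ^ j)" for z
    unfolding degree_le_3_indices a sum_9 V_def by (simp add: c_def algebra_simps)
  then have "p \<in> polys_deg_le 3" by (auto simp only: polys_deg_le_def)
  then show "p \<in> poly_space_W" by (simp add: poly_space_W_def a)
qed

section \<open>Hermitian forms that vanish on the sphere\<close>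

text \<open>A map with components in $\mathcal W$ is $A\mathbf V$ for a matrix $A$, since the entries of
  $\mathbf V$ span $\mathcal W$.\<close>

lemma linear_in_V:
  assumes "\<And>k. (\<lambda>z. f z $ k) \<in> poly_space_W"
  shows "\<exists>A :: complex^9^'n. \<forall>z. A *v V z = f z"
proof -
  have "\<exists>a :: complex^9. \<forall>z. f z $ k = (\<Sum>i\<in>UNIV. a $ i * V z $ i)" for k
    using assms[of k] by (simp only: poly_space_W_iff)
  then obtain a :: "'n \<Rightarrow> complex^9" where "\<And>k z. f z $ k = (\<Sum>i\<in>UNIV. a k $ i * V z $ i)"
    by metis
  then show ?thesis
    by (intro exI[of _ "\<chi> k. a k"]) (simp add: vec_eq_iff matrix_vector_mult_def)
qed

lemma monomial_in_W:
  assumes "1 \<le> a + b" "a + b \<le> 3"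
  shows "(\<lambda>z. (z $ 1) ^ a * (z $ 2) ^ b) \<in> poly_space_W"
proof -
  have "finite {(i, j). i + j \<le> (3::nat)}" by (simp add: degree_le_3_indices)
  then have "(z $ 1) ^ a * (z $ 2) ^ b = (\<Sum>(i, j) \<in> {(i, j). i + j \<le> 3}.
      (if i = a \<and> j = b then 1 else 0) * (z $ 1) ^ i * (z $ 2) ^ j)" for z :: "complex^2"
    using assms
    by (subst sum.remove[of _ "(a, b)"]) (auto intro!: sum.neutral split: if_splits)
  then have "(\<lambda>z. (z $ 1) ^ a * (z $ 2) ^ b) \<in> polys_deg_le 3"
    by (auto simp only: polys_deg_le_def)
  with assms show ?thesis by (auto simp: poly_space_W_def power_0_left)
qed

text \<open>The two families of exponents of the five monomials of degree one and two.\<close>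

definition quad_exponent1 :: "5 \<Rightarrow> nat" where "quad_exponent1 k = (vector [1,0,2,1,0] :: nat^5) $ k"
definition quad_exponent2 :: "5 \<Rightarrow> nat" where "quad_exponent2 k = (vector [0,1,0,1,2] :: nat^5) $ k"

definition quad_monomials :: "complex^2 \<Rightarrow> complex^5" where
  "quad_monomials z = (\<chi> k. (z $ 1) ^ quad_exponent1 k * (z $ 2) ^ quad_exponent2 k)"

lemma quad_products_independent: "M = 0" if "\<And>z. herm_form M (quad_monomials z) = 0"
proof (rule monomial_products_independent[where a = quad_exponent1 and b = quad_exponent2 and w = "\<lambda>_. 1"])
  have "\<forall>i j. quad_exponent1 i = quad_exponent1 j \<longrightarrow> quad_exponent2 i = quad_exponent2 j \<longrightarrow> i = j"
    unfolding forall_5 by (simp add: quad_exponent1_def quad_exponent2_def)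
  then show "quad_exponent1 i = quad_exponent1 j \<Longrightarrow> quad_exponent2 i = quad_exponent2 j \<Longrightarrow> i = j" for i j by blast
  show "herm_form M (\<chi> i. of_real 1 * (z $ 1) ^ quad_exponent1 i * (z $ 2) ^ quad_exponent2 i) = 0" for z :: "complex^2"
    using that[of z] by (simp add: quad_monomials_def)
qed simp

lemma quad_degree: "1 \<le> quad_exponent1 k + quad_exponent2 k \<and> quad_exponent1 k + quad_exponent2 k \<le> 2"
proof -
  have "\<forall>k. 1 \<le> quad_exponent1 k + quad_exponent2 k \<and> quad_exponent1 k + quad_exponent2 k \<le> 2"
    unfolding forall_5 by (simp add: quad_exponent1_def quad_exponent2_def)
  then show ?thesis ..
qed

lemma quad_monomials_from_V: "\<exists>J :: complex^9^5. \<forall>z. J *v V z = quad_monomials z"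
  using quad_degree by (intro linear_in_V) (simp add: quad_monomials_def monomial_in_W le_SucI numeral_eq_Suc)

text \<open>On coefficient matrices, these matrices realize multiplication of a form in the monomials of degree
  one and two by $|z_m|^2$.\<close>

lemma coordinate_times_quad_monomials_from_V: "\<exists>E :: complex^9^5. \<forall>z. E *v V z = z $ m *s quad_monomials z"
proof (rule linear_in_V)
  fix k
  have "m = 1 \<or> m = 2" using exhaust_2 by blast
  then show "(\<lambda>z. (z $ m *s quad_monomials z) $ k) \<in> poly_space_W"
    using monomial_in_W[of "Suc (quad_exponent1 k)" "quad_exponent2 k"] monomial_in_W[of "quad_exponent1 k" "Suc (quad_exponent2 k)"] quad_degree[of k]
    by (auto simp: quad_monomials_def mult_ac)
qed

definition truncated_V :: "nat \<Rightarrow> complex^2 \<Rightarrow> complex^9" where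
  "truncated_V d z = (\<chi> i. if mdeg i \<le> d then V z $ i else 0)"

lemma truncated_V_2_from_quad_monomials: "\<exists>T :: complex^5^9. \<forall>z. T *v quad_monomials z = truncated_V 2 z"
proof (intro exI allI)
  fix z
  have "\<forall>i. ((\<chi> i k. if exponent1 i = quad_exponent1 k \<and> exponent2 i = quad_exponent2 k then of_real (weight i) else 0) *v quad_monomials z) $ i
      = truncated_V 2 z $ i"
    unfolding forall_9
    by (simp add: matrix_vector_mult_def sum_5 quad_monomials_def quad_exponent1_def quad_exponent2_def exponent1_def exponent2_def truncated_V_def V_nth mdeg_def)
  then show "(\<chi> i k. if exponent1 i = quad_exponent1 k \<and> exponent2 i = quad_exponent2 k then of_real (weight i) else 0) *v quad_monomials z = truncated_V 2 z"
    by (simp add: vec_eq_iff)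
qed

text \<open>These matrices express $|z_m|^2$ times the part of bidegree $(1,1)$ as a form in the monomials of
  degree one and two.\<close>

lemma coordinate_times_truncated_V_1_from_quad_monomials: "\<exists>L :: complex^5^9. \<forall>z. L *v quad_monomials z = z $ m *s truncated_V 1 z"
proof (intro exI allI)
  fix z
  have m: "m = 1 \<or> m = 2" using exhaust_2 by blast
  let ?L = "\<chi> i k. if mdeg i = 1 \<and> exponent1 i + of_bool (m = 1) = quad_exponent1 k \<and> exponent2 i + of_bool (m = 2) = quad_exponent2 k
       then of_real (weight i) else 0"
  have "\<forall>i. (?L *v quad_monomials z) $ i = (z $ m *s truncated_V 1 z) $ i"
    using m unfolding forall_9
    by (elim disjE) (simp_all add: matrix_vector_mult_def sum_5 quad_monomials_def quad_exponent1_def quad_exponent2_def exponent1_def exponent2_def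
         truncated_V_def V_nth mdeg_def power2_eq_square)
  then show "?L *v quad_monomials z = z $ m *s truncated_V 1 z"
    by (simp add: vec_eq_iff)
qed

definition bihom_part :: "complex^9^9 \<Rightarrow> nat \<Rightarrow> nat \<Rightarrow> complex^2 \<Rightarrow> complex" where
  "bihom_part H a b z = (\<Sum>i\<in>UNIV. \<Sum>j\<in>UNIV.
     if mdeg i = a \<and> mdeg j = b then H $ i $ j * (cnj (V z $ i) * V z $ j) else 0)"

lemma bihom_part_scale: "bihom_part H a b (c *s z) = cnj c ^ a * c ^ b * bihom_part H a b z"
  unfolding bihom_part_def sum_distrib_left
  by (intro sum.cong refl) (simp add: V_scale)

lemma herm_form_V_bihom_parts:
  "herm_form H (V z) = bihom_part H 1 1 z + bihom_part H 1 2 z + bihom_part H 1 3 z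
     + bihom_part H 2 1 z + bihom_part H 2 2 z + bihom_part H 2 3 z
     + bihom_part H 3 1 z + bihom_part H 3 2 z + bihom_part H 3 3 z"
  unfolding bihom_part_def herm_form_double_sum sum.distrib[symmetric]
proof (intro sum.cong refl)
  fix i j
  show "H $ i $ j * (cnj (V z $ i) * V z $ j) =
    (if mdeg i = 1 \<and> mdeg j = 1 then H $ i $ j * (cnj (V z $ i) * V z $ j) else 0) +
    (if mdeg i = 1 \<and> mdeg j = 2 then H $ i $ j * (cnj (V z $ i) * V z $ j) else 0) +
    (if mdeg i = 1 \<and> mdeg j = 3 then H $ i $ j * (cnj (V z $ i) * V z $ j) else 0) +
    (if mdeg i = 2 \<and> mdeg j = 1 then H $ i $ j * (cnj (V z $ i) * V z $ j) else 0) +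
    (if mdeg i = 2 \<and> mdeg j = 2 then H $ i $ j * (cnj (V z $ i) * V z $ j) else 0) +
    (if mdeg i = 2 \<and> mdeg j = 3 then H $ i $ j * (cnj (V z $ i) * V z $ j) else 0) +
    (if mdeg i = 3 \<and> mdeg j = 1 then H $ i $ j * (cnj (V z $ i) * V z $ j) else 0) +
    (if mdeg i = 3 \<and> mdeg j = 2 then H $ i $ j * (cnj (V z $ i) * V z $ j) else 0) +
    (if mdeg i = 3 \<and> mdeg j = 3 then H $ i $ j * (cnj (V z $ i) * V z $ j) else 0)"
    using mdeg_cases[of i] mdeg_cases[of j] by (elim disjE) simp_all
qed

lemma herm_form_truncated_V_2:
  "herm_form H (truncated_V 2 z) = bihom_part H 1 1 z + bihom_part H 1 2 z + bihom_part H 2 1 z + bihom_part H 2 2 z"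
  unfolding bihom_part_def herm_form_double_sum sum.distrib[symmetric]
proof (intro sum.cong refl)
  fix i j
  show "H $ i $ j * (cnj (truncated_V 2 z $ i) * truncated_V 2 z $ j) =
    (if mdeg i = 1 \<and> mdeg j = 1 then H $ i $ j * (cnj (V z $ i) * V z $ j) else 0) +
    (if mdeg i = 1 \<and> mdeg j = 2 then H $ i $ j * (cnj (V z $ i) * V z $ j) else 0) +
    (if mdeg i = 2 \<and> mdeg j = 1 then H $ i $ j * (cnj (V z $ i) * V z $ j) else 0) +
    (if mdeg i = 2 \<and> mdeg j = 2 then H $ i $ j * (cnj (V z $ i) * V z $ j) else 0)"
    using mdeg_cases[of i] mdeg_cases[of j] by (elim disjE) (simp_all add: truncated_V_def)
qed

lemma herm_form_truncated_V_1: "herm_form H (truncated_V 1 z) = bihom_part H 1 1 z"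
  unfolding bihom_part_def herm_form_double_sum
proof (intro sum.cong refl)
  fix i j
  show "H $ i $ j * (cnj (truncated_V 1 z $ i) * truncated_V 1 z $ j) =
    (if mdeg i = 1 \<and> mdeg j = 1 then H $ i $ j * (cnj (V z $ i) * V z $ j) else 0)"
    using mdeg_cases[of i] mdeg_cases[of j] by (elim disjE) (simp_all add: truncated_V_def)
qed

lemma polynomial_zero_on_circle:
  fixes c :: "nat \<Rightarrow> complex"
  assumes "\<And>u. cmod u = 1 \<Longrightarrow> (\<Sum>k\<le>n. c k * u ^ k) = 0" and "k \<le> n"
  shows "c k = 0"
proof (rule ccontr)
  assume "c k \<noteq> 0"
  then have "finite {u. (\<Sum>k\<le>n. c k * u ^ k) = 0}" using assms(2) by (rule polyfun_roots_finite)
  moreover have "cis ` {0..pi} \<subseteq> {u. (\<Sum>k\<le>n. c k * u ^ k) = 0}" using assms(1) by auto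
  ultimately have "finite (cis ` {0..pi})" by (rule rev_finite_subset)
  moreover have "inj_on cis {0..pi}"
    by (intro inj_onI) (metis atLeastAtMost_iff cis.simps(1) cos_inj_pi)
  ultimately have "finite {0..pi}" by (rule finite_imageD)
  then show False by (simp add: infinite_Icc)
qed

text \<open>The circle action $z \mapsto uz$ preserves the sphere and multiplies the part of bidegree $(a,b)$
  by $u^{b-a}$; the parts with a common value of $b - a$ therefore add up to zero on the sphere.
  Inserting the powers of $\|z\|$ that make such a sum homogeneous extends the relation to all
  $z$.\<close>

lemma vanishing_on_sphere_components:
  assumes zero: "\<And>z. z \<in> sphere 0 1 \<Longrightarrow> herm_form H (V z) = 0"
  shows "bihom_part H 3 1 z = 0" "bihom_part H 1 3 z = 0"
    "of_real ((norm z)\<^sup>2) * bihom_part H 2 1 z + bihom_part H 3 2 z = 0"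
    "of_real ((norm z)\<^sup>2) * bihom_part H 1 2 z + bihom_part H 2 3 z = 0"
    "of_real ((norm z) ^ 4) * bihom_part H 1 1 z + of_real ((norm z)\<^sup>2) * bihom_part H 2 2 z
       + bihom_part H 3 3 z = 0"
proof -
  have "bihom_part H 3 1 z = 0 \<and> bihom_part H 1 3 z = 0 \<and>
    of_real ((norm z)\<^sup>2) * bihom_part H 2 1 z + bihom_part H 3 2 z = 0 \<and>
    of_real ((norm z)\<^sup>2) * bihom_part H 1 2 z + bihom_part H 2 3 z = 0 \<and>
    of_real ((norm z) ^ 4) * bihom_part H 1 1 z + of_real ((norm z)\<^sup>2) * bihom_part H 2 2 z
       + bihom_part H 3 3 z = 0"
  proof (cases "z = 0")
    case True
    then show ?thesis by (simp add: bihom_part_def cong: if_cong)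
  next
    case False
    define r where "r = norm z"
    have r: "r > 0" using False by (simp add: r_def)
    define w where "w = of_real (inverse r) *s z"
    have "w = inverse r *\<^sub>R z"
      by (simp add: w_def vec_eq_iff scaleR_conv_of_real[where 'a = complex])
    then have nw: "norm w = 1" using r by (simp add: r_def)
    have zw: "z = of_real r *s w" using r by (simp add: w_def vec_eq_iff)
    \<comment> \<open>\<open>c k\<close> collects the parts of bidegree $(a,b)$ with $b - a = k - 2$.\<close>
    define c where "c k = [bihom_part H 3 1 w, bihom_part H 2 1 w + bihom_part H 3 2 w,
      bihom_part H 1 1 w + bihom_part H 2 2 w + bihom_part H 3 3 w, bihom_part H 1 2 w + bihom_part H 2 3 w,
      bihom_part H 1 3 w] ! k" for k
    have "(\<Sum>k\<le>4. c k * u ^ k) = 0" if u: "cmod u = 1" for u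
    proof -
      have "norm (u *s w) = 1"
        using nw u by (simp add: norm_vec_def L2_set_def norm_mult power_mult_distrib)
      then have z0: "herm_form H (V (u *s w)) = 0" by (intro zero) simp
      have cu: "cnj u * u = 1"
        using u by (simp add: complex_norm_square mult.commute flip: of_real_power)
          (metis complex_norm_square mult.commute of_real_1 power_one u)
      have *: "cnj u ^ a * u ^ b * u ^ a = u ^ b" for a b
        by (metis cu mult.commute mult.left_commute mult_1 power_mult_distrib power_one)
      have **: "u\<^sup>2 * bihom_part H a b (u *s w) = cnj u ^ a * u ^ a * u ^ (2 + b - a) * bihom_part H a b w"
        if "a \<le> 2 + b" for a b
        using that by (simp add: bihom_part_scale mult_ac flip: power_add)
      have "u\<^sup>2 * bihom_part H a b (u *s w) = u ^ (2 + b - a) * bihom_part H a b w"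
        if "a \<le> 2 + b" for a b
        using **[OF that] cu by (simp flip: power_mult_distrib)
      note s = this
      have "0 = u\<^sup>2 * herm_form H (V (u *s w))" by (simp add: z0)
      also have "\<dots> = (\<Sum>k\<le>4. c k * u ^ k)"
        unfolding herm_form_V_bihom_parts distrib_left
        by (simp add: s) (simp add: c_def numeral_eq_Suc algebra_simps)
      finally show ?thesis by simp
    qed
    then have "c k = 0" if "k \<le> 4" for k
      by (rule polynomial_zero_on_circle[OF _ that])
    then have "c 0 = 0" "c 1 = 0" "c 2 = 0" "c 3 = 0" "c 4 = 0" by simp_all
    then have C: "bihom_part H 3 1 w = 0" "bihom_part H 3 2 w = - bihom_part H 2 1 w"
      "bihom_part H 3 3 w = - bihom_part H 1 1 w - bihom_part H 2 2 w" "bihom_part H 2 3 w = - bihom_part H 1 2 w"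
      "bihom_part H 1 3 w = 0"
      by (simp_all add: c_def numeral_eq_Suc add_eq_0_iff algebra_simps)
    show ?thesis
      unfolding r_def[symmetric]
      by (simp add: zw bihom_part_scale C[unfolded One_nat_def]) (simp add: algebra_simps power_numeral_reduce)
  qed
  then show "bihom_part H 3 1 z = 0" "bihom_part H 1 3 z = 0"
    "of_real ((norm z)\<^sup>2) * bihom_part H 2 1 z + bihom_part H 3 2 z = 0"
    "of_real ((norm z)\<^sup>2) * bihom_part H 1 2 z + bihom_part H 2 3 z = 0"
    "of_real ((norm z) ^ 4) * bihom_part H 1 1 z + of_real ((norm z)\<^sup>2) * bihom_part H 2 2 z
       + bihom_part H 3 3 z = 0"
    by blast+
qed

lemma hermitian_add: "hermitian A \<Longrightarrow> hermitian B \<Longrightarrow> hermitian (A + B)"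
  by (simp add: hermitian_def vec_eq_iff)

lemma hermitian_diff: "hermitian A \<Longrightarrow> hermitian B \<Longrightarrow> hermitian (A - B)"
  by (simp add: hermitian_def vec_eq_iff)

lemma hermitian_scaleR: "hermitian A \<Longrightarrow> hermitian (c *\<^sub>R A)"
  by (simp add: hermitian_def vec_eq_iff)

lemma herm_form_add: "herm_form (A + B) v = herm_form A v + herm_form B v"
  by (simp add: herm_form_double_sum sum.distrib algebra_simps)

lemma herm_form_diff: "herm_form (A - B) v = herm_form A v - herm_form B v"
  by (simp add: herm_form_double_sum sum_subtractf algebra_simps)

lemma herm_form_scaleR: "herm_form (c *\<^sub>R A) v = of_real c * herm_form A v"
  by (simp add: herm_form_double_sum sum_distrib_left algebra_simps scaleR_conv_of_real[where 'a = complex])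

lemma herm_form_scale_vec: "herm_form H (c *s v) = of_real ((cmod c)\<^sup>2) * herm_form H v"
  by (simp add: herm_form_cinner vector_scalar_commute cinner_scale_left cinner_scale_right
      complex_norm_square mult_ac del: of_real_power)

lemma norm_sq_complex2: "(norm (z :: complex^2))\<^sup>2 = (cmod (z $ 1))\<^sup>2 + (cmod (z $ 2))\<^sup>2"
  by (simp add: norm_sq_vec sum_2)

text \<open>If $p_{ab}$ are the bidegree parts, the relations above say that the form equals
  $(1 - \|z\|^2)\,q$ with $q = p_{11} + p_{12} + p_{21} + p_{22} + \|z\|^2 p_{11}$. This $q$ is a
  Hermitian form in the monomials of degree one and two.\<close>

lemma vanishing_on_sphere_divisible:
  assumes "hermitian H" and "\<And>z. z \<in> sphere 0 1 \<Longrightarrow> herm_form H (V z) = 0"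
  shows "\<exists>G :: complex^5^5. hermitian G \<and>
    (\<forall>z. herm_form H (V z) = of_real (1 - (norm z)\<^sup>2) * herm_form G (quad_monomials z))"
proof -
  obtain T :: "complex^5^9" where T: "\<And>z. T *v quad_monomials z = truncated_V 2 z"
    using truncated_V_2_from_quad_monomials by blast
  obtain L1 L2 :: "complex^5^9" where
    L1: "\<And>z. L1 *v quad_monomials z = z $ 1 *s truncated_V 1 z" and L2: "\<And>z. L2 *v quad_monomials z = z $ 2 *s truncated_V 1 z"
    using coordinate_times_truncated_V_1_from_quad_monomials by metis
  define G where "G = conj_transpose T ** H ** T + conj_transpose L1 ** H ** L1
     + conj_transpose L2 ** H ** L2"
  have "hermitian G"
    unfolding G_def by (intro hermitian_add hermitian_conjugate assms(1))
  moreover have "herm_form H (V z) = of_real (1 - (norm z)\<^sup>2) * herm_form G (quad_monomials z)" for z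
  proof -
    define s where "s = complex_of_real ((norm z)\<^sup>2)"
    have G: "herm_form G (quad_monomials z) = bihom_part H 1 1 z + bihom_part H 1 2 z + bihom_part H 2 1 z + bihom_part H 2 2 z
        + s * bihom_part H 1 1 z"
      by (simp add: G_def s_def herm_form_add herm_form_conjugate T L1 L2 herm_form_scale_vec
          herm_form_truncated_V_2 herm_form_truncated_V_1[simplified] norm_sq_complex2 algebra_simps
          del: of_real_power)
    note v = vanishing_on_sphere_components[OF assms(2), of z]
    have "complex_of_real ((norm z) ^ 4) = s * s"
      by (simp add: s_def numeral_eq_Suc)
    then have "s * bihom_part H 2 1 z + bihom_part H 3 2 z = 0" "s * bihom_part H 1 2 z + bihom_part H 2 3 z = 0"
      "s * s * bihom_part H 1 1 z + s * bihom_part H 2 2 z + bihom_part H 3 3 z = 0"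
      using v(3-5) by (simp_all only: s_def)
    then have "bihom_part H 3 2 z = - s * bihom_part H 2 1 z" "bihom_part H 2 3 z = - s * bihom_part H 1 2 z"
      "bihom_part H 3 3 z = - s * s * bihom_part H 1 1 z - s * bihom_part H 2 2 z"
      by algebra+
    with v(1,2) have "herm_form H (V z) = (1 - s) * herm_form G (quad_monomials z)"
      unfolding herm_form_V_bihom_parts G by algebra
    then show ?thesis by (simp add: s_def)
  qed
  ultimately show ?thesis by blast
qed

section \<open>The dimension of the space of Gram matrices\<close>

text \<open>A real matrix $A$ of the same size encodes a Hermitian matrix through its symmetric part (the real
  parts) and its antisymmetric part (the imaginary parts).\<close>

lemma dim_hermitian:
  "dim {G :: complex^'n^'n. hermitian G} = CARD('n) * CARD('n)"
proof -
  define h :: "real^'n^'n \<Rightarrow> complex^'n^'n" where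
    "h A = (\<chi> i j. Complex (A $ i $ j + A $ j $ i) (A $ i $ j - A $ j $ i))" for A
  have lin: "linear h"
    by (rule linearI) (simp_all add: h_def vec_eq_iff complex_eq_iff algebra_simps)
  have "h ` UNIV = {G. hermitian G}"
  proof (intro equalityI subsetI)
    fix G :: "complex^'n^'n" assume "G \<in> {G. hermitian G}"
    then have G: "cnj (G $ j $ i) = G $ i $ j" for i j
      by (metis conj_transpose_nth hermitian_def mem_Collect_eq)
    have "G $ i $ j = h (\<chi> i j. (Re (G $ i $ j) + Im (G $ i $ j)) / 2) $ i $ j" for i j
      unfolding complex_eq_iff h_def vec_lambda_beta complex.sel
      using arg_cong[OF G[of i j], of Re] arg_cong[OF G[of i j], of Im]
      by (simp_all add: field_simps)
    then have "G = h (\<chi> i j. (Re (G $ i $ j) + Im (G $ i $ j)) / 2)"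
      by (intro vec_eq_iff[THEN iffD2] allI)
    then show "G \<in> h ` UNIV" by (rule range_eqI)
  qed (auto simp: h_def hermitian_def vec_eq_iff complex_eq_iff)
  moreover have "inj h"
  proof (rule injI)
    fix A B assume "h A = h B"
    then have "A $ i $ j + A $ j $ i = B $ i $ j + B $ j $ i \<and>
      A $ i $ j - A $ j $ i = B $ i $ j - B $ j $ i" for i j
      by (simp add: h_def vec_eq_iff)
    then have "A $ i $ j = B $ i $ j" for i j by (smt (verit, best))
    then show "A = B" by (simp add: vec_eq_iff)
  qed
  ultimately have "dim {G :: complex^'n^'n. hermitian G} = dim (UNIV :: (real^'n^'n) set)"
    using dim_image_eq[OF lin, of UNIV] by (simp del: dim_UNIV)
  then show ?thesis by simp
qed

text \<open>The space of directions of \<^const>\<open>gram_space\<close>; it does not depend on \<open>g\<close>.\<close>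

definition gram_kernel :: "(complex^9^9) set" where
  "gram_kernel = {H. hermitian H \<and> (\<forall>z \<in> sphere 0 1. herm_form H (V z) = 0)}"

lemma subspace_gram_kernel: "subspace gram_kernel"
  unfolding subspace_def gram_kernel_def
  by (auto simp: hermitian_add herm_form_add hermitian_scaleR herm_form_scaleR)
     (simp_all add: hermitian_def vec_eq_iff herm_form_double_sum)

text \<open>Multiplication by $1 - \|z\|^2$ identifies the Hermitian $5 \times 5$ matrices with the
  kernel.\<close>

lemma dim_gram_kernel: "dim gram_kernel = 25"
proof -
  obtain J E1 E2 :: "complex^9^5" where J: "\<And>z. J *v V z = quad_monomials z"
    and E1: "\<And>z. E1 *v V z = z $ 1 *s quad_monomials z" and E2: "\<And>z. E2 *v V z = z $ 2 *s quad_monomials z"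
    using quad_monomials_from_V coordinate_times_quad_monomials_from_V by metis
  define \<Psi> where "\<Psi> G = conj_transpose J ** G ** J - conj_transpose E1 ** G ** E1
    - conj_transpose E2 ** G ** E2" for G
  have form: "herm_form (\<Psi> G) (V z) = of_real (1 - (norm z)\<^sup>2) * herm_form G (quad_monomials z)" for G z
    by (simp add: \<Psi>_def herm_form_diff herm_form_add herm_form_conjugate J E1 E2 herm_form_scale_vec
        norm_sq_complex2 algebra_simps del: of_real_power)
  have lin: "linear \<Psi>"
  proof (rule linearI)
    fix A B
    have "\<Psi> (A + B) - (\<Psi> A + \<Psi> B) = 0"
      by (rule V_products_independent)
        (simp add: form herm_form_add herm_form_diff distrib_left)
    then show "\<Psi> (A + B) = \<Psi> A + \<Psi> B" by simp
  next
    fix c :: real and A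
    have "\<Psi> (c *\<^sub>R A) - c *\<^sub>R \<Psi> A = 0"
      by (rule V_products_independent) (simp add: form herm_form_scaleR herm_form_diff)
    then show "\<Psi> (c *\<^sub>R A) = c *\<^sub>R \<Psi> A" by simp
  qed
  have inj: "inj \<Psi>"
  proof (rule linear_injective_0[OF lin, THEN iffD2], intro allI impI)
    fix G assume "\<Psi> G = 0"
    then have off: "herm_form G (quad_monomials z) = 0" if "norm z \<noteq> 1" for z
      using form[of G z] that power2_eq_1_iff[of "norm z"] norm_ge_zero[of z]
      by (auto simp add: herm_form_double_sum simp flip: of_real_power)
    have "herm_form G (quad_monomials z) = 0" for z
    proof (cases "norm z = 1")
      \<comment> \<open>On the sphere the factor $1 - \|z\|^2$ vanishes, and continuity along the ray is used.\<close>
      case True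
      let ?f = "\<lambda>t. herm_form G (quad_monomials (of_real t *s z))"
      have "(?f \<longlongrightarrow> ?f 1) (at (1::real))"
        unfolding herm_form_double_sum quad_monomials_def vec_lambda_beta vector_smult_component
        by (rule isContD) (intro continuous_intros)
      moreover have "(?f \<longlongrightarrow> 0) (at (1::real))"
      proof (rule tendsto_eventually)
        have "?f t = 0" if "t \<noteq> 1" "dist t 1 < 1" for t :: real
        proof (rule off)
          have "norm (of_real t *s z) = \<bar>t\<bar>"
            using norm_scaleR[of t z] True
            by (simp add: scaleR_vec_def vector_scalar_mult_def scaleR_conv_of_real[where 'a = complex])
          then show "norm (of_real t *s z) \<noteq> 1" using that by (auto simp: dist_real_def)
        qed
        then show "\<forall>\<^sub>F t in at (1::real). ?f t = 0"
          unfolding eventually_at by (intro exI[of _ 1]) auto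
      qed
      ultimately have "?f 1 = 0" by (rule tendsto_unique[OF trivial_limit_at])
      then show ?thesis by simp
    qed (rule off)
    then show "G = 0" by (rule quad_products_independent)
  qed
  have "\<Psi> ` {G. hermitian G} = gram_kernel"
  proof (intro equalityI subsetI)
    fix H assume "H \<in> \<Psi> ` {G. hermitian G}"
    then obtain G where G: "hermitian G" "H = \<Psi> G" by blast
    have "hermitian H" unfolding G(2) \<Psi>_def by (intro hermitian_diff hermitian_conjugate G(1))
    moreover have "herm_form H (V z) = 0" if "z \<in> sphere 0 1" for z
      using that by (simp add: G(2) form)
    ultimately show "H \<in> gram_kernel" by (simp add: gram_kernel_def)
  next
    fix H assume "H \<in> gram_kernel"
    then obtain G where G: "hermitian G"
      "\<And>z. herm_form H (V z) = of_real (1 - (norm z)\<^sup>2) * herm_form G (quad_monomials z)"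
      using vanishing_on_sphere_divisible[of H] by (auto simp: gram_kernel_def)
    have "H - \<Psi> G = 0"
      by (rule V_products_independent) (simp add: herm_form_diff form G(2))
    with G(1) show "H \<in> \<Psi> ` {G. hermitian G}" by auto
  qed
  then have "dim gram_kernel = dim {G :: complex^5^5. hermitian G}"
    using dim_image_eq[OF lin inj_on_subset[OF inj], of "{G. hermitian G}"] by simp
  then show ?thesis by (simp add: dim_hermitian)
qed

lemma gram_space_translate:
  assumes "H0 \<in> gram_space g"
  shows "gram_space g = (+) H0 ` gram_kernel"
proof (intro equalityI subsetI)
  fix H assume H: "H \<in> gram_space g"
  then have "H - H0 \<in> gram_kernel"
    using assms by (simp add: gram_space_def gram_kernel_def hermitian_diff herm_form_diff)
  then show "H \<in> (+) H0 ` gram_kernel" using image_eqI[of H "(+) H0" "H - H0"] by simp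
next
  fix H assume "H \<in> (+) H0 ` gram_kernel"
  then show "H \<in> gram_space g"
    using assms by (auto simp: gram_space_def gram_kernel_def hermitian_add herm_form_add)
qed

section \<open>A positive definite Gram matrix\<close>

text \<open>Completing the square twice.\<close>

lemma real_quadratic_form_3_pos:
  fixes a c d p q e x y t :: real
  assumes "0 < a" "0 < a * c - p\<^sup>2" "(a * e - p * q)\<^sup>2 < (a * c - p\<^sup>2) * (a * d - q\<^sup>2)"
    and "x \<noteq> 0 \<or> y \<noteq> 0 \<or> t \<noteq> 0"
  shows "0 < a * x\<^sup>2 + c * y\<^sup>2 + d * t\<^sup>2 + 2 * p * x * y + 2 * q * x * t + 2 * e * y * t"
    (is "0 < ?Q")
proof -
  define m where "m = a * c - p\<^sup>2"
  define n where "n = a * d - q\<^sup>2"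
  define k where "k = a * e - p * q"
  have m: "0 < m" and k: "k\<^sup>2 < m * n" using assms by (simp_all add: m_def n_def k_def)
  have eq: "m * a * ?Q = m * (a * x + p * y + q * t)\<^sup>2 + (m * y + k * t)\<^sup>2 + (m * n - k\<^sup>2) * t\<^sup>2"
    by (simp add: m_def n_def k_def power2_eq_square algebra_simps)
  have nn: "0 \<le> m * (a * x + p * y + q * t)\<^sup>2" "0 \<le> (m * y + k * t)\<^sup>2" "0 \<le> (m * n - k\<^sup>2) * t\<^sup>2"
    using m k by simp_all
  have "m * a * ?Q \<noteq> 0"
  proof
    assume "m * a * ?Q = 0"
    then have "m * (a * x + p * y + q * t)\<^sup>2 = 0" "(m * y + k * t)\<^sup>2 = 0" "(m * n - k\<^sup>2) * t\<^sup>2 = 0"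
      using eq nn by linarith+
    then have "t = 0" "m * y + k * t = 0" "a * x + p * y + q * t = 0" using m k by auto
    then show False using m assms(1,4) by auto
  qed
  then have "0 < m * a * ?Q" using eq nn by linarith
  then show ?thesis
    by (rule zero_less_mult_pos) (use m assms(1) in simp)
qed

text \<open>For real coefficients the form is the sum of its values at the real and at the imaginary parts.\<close>

lemma complex_hermitian_form_3_pos:
  fixes a c d p q e :: real and x y t :: complex
  assumes "0 < a" "0 < a * c - p\<^sup>2" "(a * e - p * q)\<^sup>2 < (a * c - p\<^sup>2) * (a * d - q\<^sup>2)"
    and nz: "x \<noteq> 0 \<or> y \<noteq> 0 \<or> t \<noteq> 0"
  shows "0 < a * (cmod x)\<^sup>2 + c * (cmod y)\<^sup>2 + d * (cmod t)\<^sup>2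
    + 2 * p * Re (cnj x * y) + 2 * q * Re (cnj x * t) + 2 * e * Re (cnj y * t)"
proof -
  define Q where "Q x y t = a * x\<^sup>2 + c * y\<^sup>2 + d * t\<^sup>2 + 2 * p * x * y + 2 * q * x * t + 2 * e * y * t"
    for x y t
  have pos: "0 < Q x y t" if "x \<noteq> 0 \<or> y \<noteq> 0 \<or> t \<noteq> 0" for x y t
    unfolding Q_def using assms(1-3) that by (rule real_quadratic_form_3_pos)
  have nonneg: "0 \<le> Q x y t" for x y t
    using pos[of x y t] by (cases "x = 0 \<and> y = 0 \<and> t = 0") (auto simp: Q_def)
  have "0 < Q (Re x) (Re y) (Re t) + Q (Im x) (Im y) (Im t)"
  proof (cases "Re x \<noteq> 0 \<or> Re y \<noteq> 0 \<or> Re t \<noteq> 0")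
    case True
    then show ?thesis using pos nonneg by (intro add_pos_nonneg) auto
  next
    case False
    then have "Im x \<noteq> 0 \<or> Im y \<noteq> 0 \<or> Im t \<noteq> 0" using nz by (auto simp: complex_eq_iff)
    then show ?thesis using pos nonneg by (intro add_nonneg_pos) auto
  qed
  then show ?thesis by (simp add: Q_def cmod_power2 algebra_simps)
qed

text \<open>A Gram matrix of $|g_\sigma|^2$ invariant under sign changes of $z_1$ and $z_2$. It couples
  only indices of equal parity type, which leaves the blocks $\{1,6,8\}$, $\{2,7,9\}$ and a diagonal
  block in degree two. The entries between degree one and degree three are the coefficients of
  $\|z\|^2(\sigma_1 z_1^2 + \sigma_2 z_2^2)$; those within degree three turn the form, on the sphere,
  into $|g_\sigma|^2$ for every choice of $a$, $b$ and $\delta$.\<close>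

definition parity_gram :: "real \<Rightarrow> real \<Rightarrow> real \<Rightarrow> real \<Rightarrow> real \<Rightarrow> complex^9^9" where
  "parity_gram \<sigma>1 \<sigma>2 a b \<delta> =
    (let c = complex_of_real; r = sqrt 3 in vector
     [vector [c a, 0, 0, 0, 0, c \<sigma>1, 0, c (\<sigma>2 / r), 0],
      vector [0, c b, 0, 0, 0, 0, c (\<sigma>1 / r), 0, c \<sigma>2],
      vector [0, 0, c \<delta>, 0, 0, 0, 0, 0, 0],
      vector [0, 0, 0, c \<delta>, 0, 0, 0, 0, 0],
      vector [0, 0, 0, 0, c \<delta>, 0, 0, 0, 0],
      vector [c \<sigma>1, 0, 0, 0, 0, c (1 + \<sigma>1\<^sup>2 - a - \<delta>), 0, c (\<sigma>1 * \<sigma>2 / r), 0],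
      vector [0, c (\<sigma>1 / r), 0, 0, 0, 0, c (1 + (\<sigma>1\<^sup>2 - 2 * a - b) / 3 - \<delta>), 0, c (\<sigma>1 * \<sigma>2 / r)],
      vector [c (\<sigma>2 / r), 0, 0, 0, 0, c (\<sigma>1 * \<sigma>2 / r), 0, c (1 + (\<sigma>2\<^sup>2 - a - 2 * b) / 3 - \<delta>), 0],
      vector [0, c \<sigma>2, 0, 0, 0, 0, c (\<sigma>1 * \<sigma>2 / r), 0, c (1 + \<sigma>2\<^sup>2 - b - \<delta>)]])"

lemma hermitian_parity_gram: "hermitian (parity_gram \<sigma>1 \<sigma>2 a b \<delta>)"
proof -
  have "\<forall>i j. conj_transpose (parity_gram \<sigma>1 \<sigma>2 a b \<delta>) $ i $ j = parity_gram \<sigma>1 \<sigma>2 a b \<delta> $ i $ j"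
    unfolding forall_9 by (simp add: parity_gram_def Let_def)
  then show ?thesis by (simp add: hermitian_def vec_eq_iff)
qed

lemma herm_form_real:
  assumes "hermitian H"
  shows "herm_form H v = of_real (Re (herm_form H v))"
proof -
  have "cnj (herm_form H v) = herm_form H v"
    using assms by (metis cinner_adjoint cinner_commute herm_form_cinner hermitian_def)
  then show ?thesis by (simp add: complex_eq_iff)
qed

lemma Re_herm_form_parity_gram:
  "Re (herm_form (parity_gram \<sigma>1 \<sigma>2 a b \<delta>) v) =
     (a * (cmod (v $ 1))\<^sup>2 + (1 + \<sigma>1\<^sup>2 - a - \<delta>) * (cmod (v $ 6))\<^sup>2
       + (1 + (\<sigma>2\<^sup>2 - a - 2 * b) / 3 - \<delta>) * (cmod (v $ 8))\<^sup>2
       + 2 * \<sigma>1 * Re (cnj (v $ 1) * v $ 6) + 2 * (\<sigma>2 / sqrt 3) * Re (cnj (v $ 1) * v $ 8)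
       + 2 * (\<sigma>1 * \<sigma>2 / sqrt 3) * Re (cnj (v $ 6) * v $ 8))
   + (b * (cmod (v $ 2))\<^sup>2 + (1 + \<sigma>2\<^sup>2 - b - \<delta>) * (cmod (v $ 9))\<^sup>2
       + (1 + (\<sigma>1\<^sup>2 - 2 * a - b) / 3 - \<delta>) * (cmod (v $ 7))\<^sup>2
       + 2 * \<sigma>2 * Re (cnj (v $ 2) * v $ 9) + 2 * (\<sigma>1 / sqrt 3) * Re (cnj (v $ 2) * v $ 7)
       + 2 * (\<sigma>1 * \<sigma>2 / sqrt 3) * Re (cnj (v $ 9) * v $ 7))
   + \<delta> * ((cmod (v $ 3))\<^sup>2 + (cmod (v $ 4))\<^sup>2 + (cmod (v $ 5))\<^sup>2)"
  unfolding herm_form_double_sum sum_9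
  by (simp add: parity_gram_def Let_def cmod_power2) (simp add: power2_eq_square algebra_simps)

lemma parity_gram_in_gram_space:
  "parity_gram \<sigma>1 \<sigma>2 a b \<delta> \<in> gram_space (g_sigma \<sigma>1 \<sigma>2)"
proof -
  have "Re (herm_form (parity_gram \<sigma>1 \<sigma>2 a b \<delta>) (V z)) = (cmod (g_sigma \<sigma>1 \<sigma>2 z))\<^sup>2"
    if z: "norm z = 1" for z
  proof -
    define u w where "u = z $ 1" and "w = z $ 2"
    define X Y where "X = (cmod u)\<^sup>2" and "Y = (cmod w)\<^sup>2"
    have Y: "Y = 1 - X" using norm_sq_complex2[of z] z by (simp add: X_def Y_def u_def w_def)
    define A B C where "A = Re (u\<^sup>2)" and "B = Re (w\<^sup>2)" and "C = Re ((cnj u)\<^sup>2 * w\<^sup>2)"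
    note defs = X_def Y_def A_def B_def C_def
    have n: "(cmod (u\<^sup>2))\<^sup>2 = X\<^sup>2" "(cmod (w\<^sup>2))\<^sup>2 = Y\<^sup>2" "(cmod (u ^ 3))\<^sup>2 = X ^ 3" "(cmod (w ^ 3))\<^sup>2 = Y ^ 3"
      "(cmod (of_real (sqrt 2) * u * w))\<^sup>2 = 2 * X * Y"
      "(cmod (of_real (sqrt 3) * u\<^sup>2 * w))\<^sup>2 = 3 * X\<^sup>2 * Y"
      "(cmod (of_real (sqrt 3) * u * w\<^sup>2))\<^sup>2 = 3 * X * Y\<^sup>2"
      by (simp_all add: defs norm_mult norm_power power_mult_distrib flip: power_mult)
    have m: "Re (cnj u * u ^ 3) = X * A" "Re (cnj w * w ^ 3) = Y * B"
      "Re (cnj u * (of_real (sqrt 3) * u * w\<^sup>2)) = sqrt 3 * X * B"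
      "Re (cnj w * (of_real (sqrt 3) * u\<^sup>2 * w)) = sqrt 3 * Y * A"
      "Re (cnj (u ^ 3) * (of_real (sqrt 3) * u * w\<^sup>2)) = sqrt 3 * X * C"
      "Re (cnj (w ^ 3) * (of_real (sqrt 3) * u\<^sup>2 * w)) = sqrt 3 * Y * C"
      by (simp_all add: defs cmod_power2 power3_eq_cube) (simp_all add: power2_eq_square algebra_simps)
    have g: "(cmod (g_sigma \<sigma>1 \<sigma>2 z))\<^sup>2 = 1 + \<sigma>1\<^sup>2 * X\<^sup>2 + \<sigma>2\<^sup>2 * Y\<^sup>2
        + 2 * \<sigma>1 * A + 2 * \<sigma>2 * B + 2 * \<sigma>1 * \<sigma>2 * C"
      by (simp add: g_sigma_def defs cmod_power2 flip: u_def w_def)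
        (simp add: power2_eq_square algebra_simps)
    show ?thesis
      unfolding Re_herm_form_parity_gram g V_def vector_9 u_def[symmetric] w_def[symmetric]
        n m X_def[symmetric] Y_def[symmetric] unfolding Y
      by (simp add: field_simps power2_eq_square power3_eq_cube)
  qed
  then have "herm_form (parity_gram \<sigma>1 \<sigma>2 a b \<delta>) (V z) = of_real ((cmod (g_sigma \<sigma>1 \<sigma>2 z))\<^sup>2)"
    if "norm z = 1" for z
    using that by (subst herm_form_real[OF hermitian_parity_gram]) simp
  then show ?thesis by (simp add: gram_space_def hermitian_parity_gram)
qed

text \<open>Let $s = \sqrt{1 - \sigma_1^2}$, $t = \sqrt{1 - \sigma_2^2}$, $a = 1 - \epsilon s$ and
  $b = 1 - \epsilon t$. For $\delta = 0$ the determinants of the two $3 \times 3$ blocks are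
  positive multiples of $s(s^2 + t^2 - 1 - \epsilon s) + 2t(s^2 - \epsilon s)$ and of the same
  expression with $s$ and $t$ exchanged. At $\epsilon = 0$ these are $s((s+t)^2 - 1)$ and
  $t((s+t)^2 - 1)$, which are positive because $s + t > 1$. A small $\delta > 0$ makes the block in
  degree two positive without destroying this.\<close>

lemma pos_def_parity_gram:
  assumes \<sigma>: "0 \<le> \<sigma>2" "\<sigma>2 \<le> \<sigma>1" "\<sigma>1 < 1"
    and gt: "sqrt (1 - \<sigma>1\<^sup>2) + sqrt (1 - \<sigma>2\<^sup>2) > 1"
  shows "\<exists>a b \<delta>. pos_def (parity_gram \<sigma>1 \<sigma>2 a b \<delta>)"
proof -
  define s where "s = sqrt (1 - \<sigma>1\<^sup>2)"
  define t where "t = sqrt (1 - \<sigma>2\<^sup>2)"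
  have "\<sigma>1\<^sup>2 < 1" "\<sigma>2\<^sup>2 < 1" using \<sigma> by (simp_all add: power_less_one_iff abs_square_less_1)
  then have st: "s > 0" "t > 0" and s2: "\<sigma>1\<^sup>2 = 1 - s\<^sup>2" and t2: "\<sigma>2\<^sup>2 = 1 - t\<^sup>2"
    by (simp_all add: s_def t_def)
  have pos: "(s + t)\<^sup>2 > 1" using gt unfolding s_def[symmetric] t_def[symmetric]
    by (simp add: one_less_power)
  have ev: "\<forall>\<^sub>F x in at_right (0::real). 0 < f x" if "isCont f 0" "0 < f 0" for f :: "real \<Rightarrow> real"
    using order_tendstoD(1)[OF tendsto_within_subset[OF that(1)[unfolded isCont_def] subset_UNIV] that(2)] .
  have "\<forall>\<^sub>F \<epsilon> in at_right (0::real). 0 < \<epsilon> \<and> 0 < 1 - \<epsilon> * s \<and> 0 < 1 - \<epsilon> * t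
      \<and> 0 < s\<^sup>2 - \<epsilon> * s \<and> 0 < t\<^sup>2 - \<epsilon> * t
      \<and> 0 < s * (s\<^sup>2 + t\<^sup>2 - 1 - \<epsilon> * s) + 2 * t * (s\<^sup>2 - \<epsilon> * s)
      \<and> 0 < t * (s\<^sup>2 + t\<^sup>2 - 1 - \<epsilon> * t) + 2 * s * (t\<^sup>2 - \<epsilon> * t)"
  proof (rule eventually_conj[OF eventually_at_right_less], intro eventually_conj ev)
    have "s * ((s + t)\<^sup>2 - 1) > 0" "t * ((s + t)\<^sup>2 - 1) > 0" using pos st by simp_all
    then show "0 < s * (s\<^sup>2 + t\<^sup>2 - 1 - 0 * s) + 2 * t * (s\<^sup>2 - 0 * s)"
      "0 < t * (s\<^sup>2 + t\<^sup>2 - 1 - 0 * t) + 2 * s * (t\<^sup>2 - 0 * t)"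
      by (simp_all add: power2_eq_square algebra_simps)
  qed (use st in \<open>auto intro!: continuous_intros\<close>)
  from eventually_happens'[OF trivial_limit_at_right_real this]
  obtain \<epsilon> where \<epsilon>: "0 < \<epsilon>" "0 < 1 - \<epsilon> * s" "0 < 1 - \<epsilon> * t"
      "0 < s\<^sup>2 - \<epsilon> * s" "0 < t\<^sup>2 - \<epsilon> * t"
      "0 < s * (s\<^sup>2 + t\<^sup>2 - 1 - \<epsilon> * s) + 2 * t * (s\<^sup>2 - \<epsilon> * s)"
      "0 < t * (s\<^sup>2 + t\<^sup>2 - 1 - \<epsilon> * t) + 2 * s * (t\<^sup>2 - \<epsilon> * t)" by blast
  define a where "a = 1 - \<epsilon> * s"
  define b where "b = 1 - \<epsilon> * t"
  define r where "r = sqrt (3::real)"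
  have r2: "r\<^sup>2 = 3" by (simp add: r_def)
  \<comment> \<open>The left-hand side is $a$ times the determinant of a block. Since $\sqrt 3$ enters only through
    $r^2 = 3$, the right-hand side is a polynomial in the parameters.\<close>
  have det: "((a * c - p\<^sup>2) * (a * d - (q / r)\<^sup>2)) - (a * (p * q / r) - p * (q / r))\<^sup>2
     = (a * c - p\<^sup>2) * (a * d - q\<^sup>2 / 3) - p\<^sup>2 * q\<^sup>2 * (a - 1)\<^sup>2 / 3" for a c d p q :: real
    by (simp add: power_divide r2 power_mult_distrib diff_divide_distrib[symmetric]
        left_diff_distrib[symmetric])
       (simp add: power2_eq_square algebra_simps)
  have D1: "(a * (1 + \<sigma>1\<^sup>2 - a) - \<sigma>1\<^sup>2) * (a * (1 + (\<sigma>2\<^sup>2 - a - 2 * b) / 3) - \<sigma>2\<^sup>2 / 3)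
      - \<sigma>1\<^sup>2 * \<sigma>2\<^sup>2 * (a - 1)\<^sup>2 / 3
     = \<epsilon>\<^sup>2 * s * a * (s * (s\<^sup>2 + t\<^sup>2 - 1 - \<epsilon> * s) + 2 * t * (s\<^sup>2 - \<epsilon> * s)) / 3"
    unfolding s2 t2 a_def b_def by (simp add: field_simps power2_eq_square)
  have D2: "(b * (1 + \<sigma>2\<^sup>2 - b) - \<sigma>2\<^sup>2) * (b * (1 + (\<sigma>1\<^sup>2 - 2 * a - b) / 3) - \<sigma>1\<^sup>2 / 3)
      - \<sigma>2\<^sup>2 * \<sigma>1\<^sup>2 * (b - 1)\<^sup>2 / 3
     = \<epsilon>\<^sup>2 * t * b * (t * (s\<^sup>2 + t\<^sup>2 - 1 - \<epsilon> * t) + 2 * s * (t\<^sup>2 - \<epsilon> * t)) / 3"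
    unfolding s2 t2 a_def b_def by (simp add: field_simps power2_eq_square)
  have D1': "0 < (a * (1 + \<sigma>1\<^sup>2 - a) - \<sigma>1\<^sup>2) * (a * (1 + (\<sigma>2\<^sup>2 - a - 2 * b) / 3) - \<sigma>2\<^sup>2 / 3)
      - \<sigma>1\<^sup>2 * \<sigma>2\<^sup>2 * (a - 1)\<^sup>2 / 3"
    unfolding D1 using \<epsilon> st by (simp add: a_def)
  have D2': "0 < (b * (1 + \<sigma>2\<^sup>2 - b) - \<sigma>2\<^sup>2) * (b * (1 + (\<sigma>1\<^sup>2 - 2 * a - b) / 3) - \<sigma>1\<^sup>2 / 3)
      - \<sigma>2\<^sup>2 * \<sigma>1\<^sup>2 * (b - 1)\<^sup>2 / 3"
    unfolding D2 using \<epsilon> st by (simp add: b_def)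
  have M1: "a * (1 + \<sigma>1\<^sup>2 - a) - \<sigma>1\<^sup>2 = \<epsilon> * s * (s\<^sup>2 - \<epsilon> * s)"
    unfolding s2 a_def by (simp add: power2_eq_square algebra_simps)
  have M2: "b * (1 + \<sigma>2\<^sup>2 - b) - \<sigma>2\<^sup>2 = \<epsilon> * t * (t\<^sup>2 - \<epsilon> * t)"
    unfolding t2 b_def by (simp add: power2_eq_square algebra_simps)
  have M1': "0 < a * (1 + \<sigma>1\<^sup>2 - a) - \<sigma>1\<^sup>2" and M2': "0 < b * (1 + \<sigma>2\<^sup>2 - b) - \<sigma>2\<^sup>2"
    unfolding M1 M2 using \<epsilon> st by simp_all
  have "\<forall>\<^sub>F \<delta> in at_right (0::real). 0 < \<delta>
      \<and> 0 < a * (1 + \<sigma>1\<^sup>2 - a - \<delta>) - \<sigma>1\<^sup>2 \<and> 0 < b * (1 + \<sigma>2\<^sup>2 - b - \<delta>) - \<sigma>2\<^sup>2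
      \<and> 0 < (a * (1 + \<sigma>1\<^sup>2 - a - \<delta>) - \<sigma>1\<^sup>2) * (a * (1 + (\<sigma>2\<^sup>2 - a - 2 * b) / 3 - \<delta>) - \<sigma>2\<^sup>2 / 3)
      - \<sigma>1\<^sup>2 * \<sigma>2\<^sup>2 * (a - 1)\<^sup>2 / 3
      \<and> 0 < (b * (1 + \<sigma>2\<^sup>2 - b - \<delta>) - \<sigma>2\<^sup>2) * (b * (1 + (\<sigma>1\<^sup>2 - 2 * a - b) / 3 - \<delta>) - \<sigma>1\<^sup>2 / 3)
      - \<sigma>2\<^sup>2 * \<sigma>1\<^sup>2 * (b - 1)\<^sup>2 / 3"
  proof (rule eventually_conj[OF eventually_at_right_less], intro eventually_conj ev)
  qed (use M1' M2' D1' D2' in \<open>auto intro!: continuous_intros\<close>)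
  from eventually_happens'[OF trivial_limit_at_right_real this]
  obtain \<delta> where \<delta>: "0 < \<delta>"
      "0 < a * (1 + \<sigma>1\<^sup>2 - a - \<delta>) - \<sigma>1\<^sup>2" "0 < b * (1 + \<sigma>2\<^sup>2 - b - \<delta>) - \<sigma>2\<^sup>2"
      "0 < (a * (1 + \<sigma>1\<^sup>2 - a - \<delta>) - \<sigma>1\<^sup>2) * (a * (1 + (\<sigma>2\<^sup>2 - a - 2 * b) / 3 - \<delta>) - \<sigma>2\<^sup>2 / 3)
      - \<sigma>1\<^sup>2 * \<sigma>2\<^sup>2 * (a - 1)\<^sup>2 / 3"
      "0 < (b * (1 + \<sigma>2\<^sup>2 - b - \<delta>) - \<sigma>2\<^sup>2) * (b * (1 + (\<sigma>1\<^sup>2 - 2 * a - b) / 3 - \<delta>) - \<sigma>1\<^sup>2 / 3)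
      - \<sigma>2\<^sup>2 * \<sigma>1\<^sup>2 * (b - 1)\<^sup>2 / 3" by blast
  have ab: "0 < a" "0 < b" using \<epsilon> by (simp_all add: a_def b_def)
  have "pos_def (parity_gram \<sigma>1 \<sigma>2 a b \<delta>)"
    unfolding pos_def_def
  proof (intro conjI allI impI hermitian_parity_gram)
    fix v :: "complex^9" assume v: "v \<noteq> 0"
    define X where "X = a * (cmod (v $ 1))\<^sup>2 + (1 + \<sigma>1\<^sup>2 - a - \<delta>) * (cmod (v $ 6))\<^sup>2
       + (1 + (\<sigma>2\<^sup>2 - a - 2 * b) / 3 - \<delta>) * (cmod (v $ 8))\<^sup>2
       + 2 * \<sigma>1 * Re (cnj (v $ 1) * v $ 6) + 2 * (\<sigma>2 / r) * Re (cnj (v $ 1) * v $ 8)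
       + 2 * (\<sigma>1 * \<sigma>2 / r) * Re (cnj (v $ 6) * v $ 8)"
    define Y where "Y = b * (cmod (v $ 2))\<^sup>2 + (1 + \<sigma>2\<^sup>2 - b - \<delta>) * (cmod (v $ 9))\<^sup>2
       + (1 + (\<sigma>1\<^sup>2 - 2 * a - b) / 3 - \<delta>) * (cmod (v $ 7))\<^sup>2
       + 2 * \<sigma>2 * Re (cnj (v $ 2) * v $ 9) + 2 * (\<sigma>1 / r) * Re (cnj (v $ 2) * v $ 7)
       + 2 * (\<sigma>1 * \<sigma>2 / r) * Re (cnj (v $ 9) * v $ 7)"
    define Z where "Z = \<delta> * ((cmod (v $ 3))\<^sup>2 + (cmod (v $ 4))\<^sup>2 + (cmod (v $ 5))\<^sup>2)"
    have X: "0 < X" if "v $ 1 \<noteq> 0 \<or> v $ 6 \<noteq> 0 \<or> v $ 8 \<noteq> 0"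
      unfolding X_def
      using ab(1) \<delta>(2) _ that
      by (rule complex_hermitian_form_3_pos) (use \<delta>(4) det[of a _ \<sigma>1 _ \<sigma>2] in \<open>metis diff_gt_0_iff_gt\<close>)
    have Y: "0 < Y" if "v $ 2 \<noteq> 0 \<or> v $ 9 \<noteq> 0 \<or> v $ 7 \<noteq> 0"
      unfolding Y_def
      using ab(2) \<delta>(3) _ that
      by (rule complex_hermitian_form_3_pos)
         (use \<delta>(5) det[of b _ \<sigma>2 _ \<sigma>1] in \<open>metis diff_gt_0_iff_gt mult.commute\<close>)
    have Z: "0 < Z" if "v $ 3 \<noteq> 0 \<or> v $ 4 \<noteq> 0 \<or> v $ 5 \<noteq> 0"
    proof -
      have "0 < (cmod (v $ 3))\<^sup>2 \<or> 0 < (cmod (v $ 4))\<^sup>2 \<or> 0 < (cmod (v $ 5))\<^sup>2" using that by simp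
      then have "0 < (cmod (v $ 3))\<^sup>2 + (cmod (v $ 4))\<^sup>2 + (cmod (v $ 5))\<^sup>2"
        using zero_le_power2[of "cmod (v $ 3)"] zero_le_power2[of "cmod (v $ 4)"]
          zero_le_power2[of "cmod (v $ 5)"] by linarith
      then show ?thesis using \<delta>(1) by (simp add: Z_def)
    qed
    have nonneg: "0 \<le> X" "0 \<le> Y" "0 \<le> Z"
      using X Y Z by (force simp: X_def, force simp: Y_def, force simp: Z_def)
    have "\<not> (\<forall>i. v $ i = 0)" using v by (simp add: vec_eq_iff)
    then have "0 < X + Y + Z" unfolding forall_9 using X Y Z nonneg by fastforce
    then show "0 < Re (herm_form (parity_gram \<sigma>1 \<sigma>2 a b \<delta>) v)"
      unfolding Re_herm_form_parity_gram by (simp add: X_def Y_def Z_def r_def)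
  qed
  then show ?thesis by blast
qed

section \<open>Holomorphy of quotients of polynomials\<close>

definition complex_differentiable_at :: "(complex^'m \<Rightarrow> complex) \<Rightarrow> complex^'m \<Rightarrow> bool" where
  "complex_differentiable_at f z \<longleftrightarrow>
    (\<exists>f'. (f has_derivative f') (at z) \<and> (\<forall>c v. f' (c *s v) = c * f' v))"

lemma complex_differentiable_const: "complex_differentiable_at (\<lambda>_. c) z"
  unfolding complex_differentiable_at_def by (intro exI[of _ "\<lambda>_. 0"]) simp

lemma complex_differentiable_coordinate: "complex_differentiable_at (\<lambda>z. z $ k) z"
  unfolding complex_differentiable_at_def
  by (intro exI[of _ "\<lambda>v. v $ k"])
     (simp add: bounded_linear_imp_has_derivative bounded_linear_vec_nth)

lemma complex_differentiable_add:
  "complex_differentiable_at f z \<Longrightarrow> complex_differentiable_at g z \<Longrightarrow>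
    complex_differentiable_at (\<lambda>z. f z + g z) z"
  unfolding complex_differentiable_at_def
  by (elim exE conjE, rule exI, rule conjI, erule (1) has_derivative_add) (simp add: algebra_simps)

lemma complex_differentiable_mult:
  "complex_differentiable_at f z \<Longrightarrow> complex_differentiable_at g z \<Longrightarrow>
    complex_differentiable_at (\<lambda>z. f z * g z) z"
  unfolding complex_differentiable_at_def
  by (elim exE conjE, rule exI, rule conjI, erule (1) has_derivative_mult) (simp add: algebra_simps)

lemma complex_differentiable_inverse:
  "complex_differentiable_at f z \<Longrightarrow> f z \<noteq> 0 \<Longrightarrow> complex_differentiable_at (\<lambda>z. inverse (f z)) z"
  unfolding complex_differentiable_at_def
  by (elim exE conjE, rule exI, rule conjI, erule (1) Deriv.has_derivative_inverse) (simp add: algebra_simps)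

lemma complex_differentiable_power:
  "complex_differentiable_at f z \<Longrightarrow> complex_differentiable_at (\<lambda>z. f z ^ n) z"
  by (induction n) (simp_all add: complex_differentiable_const complex_differentiable_mult)

lemma complex_differentiable_sum:
  "(\<And>i. i \<in> I \<Longrightarrow> complex_differentiable_at (f i) z) \<Longrightarrow>
    complex_differentiable_at (\<lambda>z. \<Sum>i\<in>I. f i z) z"
  by (induction I rule: infinite_finite_induct)
     (simp_all add: complex_differentiable_const complex_differentiable_add)

lemma complex_differentiable_polys:
  assumes "p \<in> polys"
  shows "complex_differentiable_at p z"
proof -
  obtain d c where "p = (\<lambda>z. \<Sum>(i, j) \<in> {(i, j). i + j \<le> d}. c i j * (z $ 1) ^ i * (z $ 2) ^ j)"
    using assms by (auto simp: polys_def polys_deg_le_def fun_eq_iff)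
  then show ?thesis
    by (auto simp: case_prod_unfold intro!: complex_differentiable_sum complex_differentiable_mult
        complex_differentiable_power complex_differentiable_const complex_differentiable_coordinate)
qed

text \<open>The derivative of a vector-valued map is assembled from those of its components.\<close>

lemma holomorphic_map_onI:
  fixes F :: "complex^'m \<Rightarrow> complex^'n"
  assumes "\<And>z k. z \<in> S \<Longrightarrow> complex_differentiable_at (\<lambda>z. F z $ k) z"
  shows "holomorphic_map_on F S"
  unfolding holomorphic_map_on_def
proof
  fix z assume "z \<in> S"
  then have "\<exists>f'. ((\<lambda>z. F z $ k) has_derivative f') (at z) \<and> (\<forall>c v. f' (c *s v) = c * f' v)" for k
    using assms unfolding complex_differentiable_at_def by blast
  then obtain f' where f': "\<And>k. ((\<lambda>z. F z $ k) has_derivative f' k) (at z)"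
    and scale: "\<And>k c v. f' k (c *s v) = c * f' k v" by metis
  define F' where "F' v = (\<chi> k. f' k v)" for v
  have "(F has_derivative F') (at z)"
  proof -
    have bl: "bounded_linear (\<lambda>c. c *s axis k (1::complex) :: complex^'n)" for k
      by (intro linear_conv_bounded_linear[THEN iffD1] linearI)
         (simp_all add: vec_eq_iff algebra_simps)
    have "((\<lambda>z. \<Sum>k\<in>UNIV. F z $ k *s axis k 1) has_derivative (\<lambda>v. \<Sum>k\<in>UNIV. f' k v *s axis k 1)) (at z)"
      by (intro has_derivative_sum bounded_linear.has_derivative[OF bl] f')
    moreover have "(\<Sum>k\<in>UNIV. x $ k *s axis k 1) = x" for x :: "complex^'n"
      by (rule basis_expansion)
    moreover have "(\<Sum>k\<in>UNIV. f' k v *s axis k 1) = F' v" for v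
      using basis_expansion[of "F' v"] by (simp add: F'_def)
    ultimately show ?thesis by simp
  qed
  moreover have "Vector_Spaces.linear (*s) (*s) F'"
  proof unfold_locales
    show "F' (x + y) = F' x + F' y" for x y
      using has_derivative_bounded_linear[OF f'] by (simp add: F'_def vec_eq_iff bounded_linear.linear linear_add)
    show "F' (c *s x) = c *s F' x" for c x by (simp add: F'_def vec_eq_iff scale)
  qed
  ultimately show "\<exists>F'. (F has_derivative F') (at z) \<and> Vector_Spaces.linear (*s) (*s) F'" by blast
qed

lemma polys_deg_le_polys: "p \<in> polys_deg_le d \<Longrightarrow> p \<in> polys"
  by (auto simp: polys_def)

section \<open>Full-rank maps and their Gram matrices\<close>

lemma linear_V_component_in_W: "(\<lambda>z. (C *v V z) $ k) \<in> poly_space_W"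
  unfolding poly_space_W_iff
  by (intro exI[of _ "C $ k"]) (simp add: matrix_vector_mult_def)

lemma linear_combination_linear_V:
  "(\<Sum>k\<in>UNIV. a $ k * (C *v V z) $ k) = (\<Sum>i\<in>UNIV. (\<chi> i. \<Sum>k\<in>UNIV. a $ k * C $ k $ i) $ i * V z $ i)"
  by (simp add: matrix_vector_mult_def sum_distrib_left sum_distrib_right mult.assoc) (rule sum.swap)

text \<open>Both sides say that $C$ has a left inverse: full rank writes each entry of $\mathbf V$ as a linear
  combination of the entries of $C\mathbf V$.\<close>

lemma full_rank_linear_V_iff:
  fixes C :: "complex^9^'n"
  shows "full_rank (\<lambda>z. C *v V z) \<longleftrightarrow> inj ((*v) C)"
proof
  assume full: "full_rank (\<lambda>z. C *v V z)"
  have "\<exists>a :: complex^'n. \<forall>z. (\<Sum>k\<in>UNIV. a $ k * (C *v V z) $ k) = V z $ i" for i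
  proof -
    have "(\<lambda>z. V z $ i) \<in> poly_space_W"
      using linear_V_component_in_W[of "mat 1" i] by simp
    then show ?thesis using full unfolding full_rank_def by (auto simp: fun_eq_iff dest!: equalityD2 subsetD)
  qed
  then obtain a :: "9 \<Rightarrow> complex^'n" where
    a: "\<And>i z. (\<Sum>k\<in>UNIV. a i $ k * (C *v V z) $ k) = V z $ i" by metis
  have "(\<chi> i. a i) ** C = mat 1"
  proof (rule V_independent)
    fix z
    have "(\<chi> i. a i) *v (C *v V z) = V z"
      using a[of _ z] by (simp add: vec_eq_iff matrix_vector_mult_def[of "\<chi> i. a i"])
    then show "((\<chi> i. a i) ** C) *v V z = mat 1 *v V z" by (simp add: matrix_vector_mul_assoc)
  qed
  then show "inj ((*v) C)" using matrix_left_invertible_injective by blast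
next
  assume "inj ((*v) C)"
  then obtain B where B: "B ** C = mat 1" using matrix_left_invertible_injective by blast
  show "full_rank (\<lambda>z. C *v V z)"
    unfolding full_rank_def
  proof (intro equalityI subsetI)
    fix p assume "p \<in> range (\<lambda>a :: complex^'n. \<lambda>z. \<Sum>k\<in>UNIV. a $ k * (C *v V z) $ k)"
    then show "p \<in> poly_space_W"
      unfolding poly_space_W_iff linear_combination_linear_V by blast
  next
    fix p assume "p \<in> poly_space_W"
    then obtain b :: "complex^9" where b: "\<And>z. p z = (\<Sum>i\<in>UNIV. b $ i * V z $ i)"
      using poly_space_W_iff by metis
    have "p z = (\<Sum>k\<in>UNIV. (\<chi> k. \<Sum>i\<in>UNIV. b $ i * B $ i $ k) $ k * (C *v V z) $ k)" for z
    proof -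
      have "V z = B *v (C *v V z)" by (simp add: matrix_vector_mul_assoc B)
      then have "p z = (\<Sum>i\<in>UNIV. b $ i * (B *v (C *v V z)) $ i)" using b[of z] by simp
      also have "\<dots> = (\<Sum>k\<in>UNIV. (\<chi> k. \<Sum>i\<in>UNIV. b $ i * B $ i $ k) $ k * (C *v V z) $ k)"
        by (simp add: matrix_vector_mult_def[of B] sum_distrib_left sum_distrib_right mult.assoc)
           (rule sum.swap)
      finally show ?thesis .
    qed
    then show "p \<in> range (\<lambda>a :: complex^'n. \<lambda>z. \<Sum>k\<in>UNIV. a $ k * (C *v V z) $ k)"
      by (intro range_eqI ext)
  qed
qed

lemma gram_linear_V: "gram (\<lambda>z. C *v V z) = conj_transpose C ** C"
proof -
  have "(THE D. (\<lambda>z. C *v V z) = (\<lambda>z. D *v V z)) = C"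
    by (rule the_equality) (auto simp: fun_eq_iff intro: V_independent)
  then show ?thesis by (simp add: gram_def)
qed

lemma full_rank_maps_linear_V:
  assumes "P \<in> full_rank_maps g"
  obtains C where "P = (\<lambda>z. C *v V z)"
proof -
  have "(\<lambda>z. P z $ k) \<in> poly_space_W" for k
    using assms by (simp add: full_rank_maps_def poly_space_W_def normalized_def)
  then show ?thesis using linear_in_V[of P] that by (metis ext)
qed

text \<open>Every such map is holomorphic on the ball, as the denominator does not vanish there. Two
  conditions remain: the sphere condition, which involves $C$ only through
  $\|C\mathbf V\|^2 = \mathbf V^* C^* C \mathbf V$, and full rank, which is the positivity of
  $C^* C$.\<close>

lemma linear_V_full_rank_maps_iff:
  fixes C :: "complex^9^'n"
  assumes g: "g \<in> polys" "\<forall>z \<in> ball 0 1. g z \<noteq> 0" "g 0 = 1"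
  shows "(\<lambda>z. C *v V z) \<in> full_rank_maps g \<longleftrightarrow>
    conj_transpose C ** C \<in> full_rank_spectrahedron g"
proof -
  have poly: "(\<lambda>z. (C *v V z) $ k) \<in> polys_deg_le 3" for k
    using linear_V_component_in_W[of C k] by (simp add: poly_space_W_def)
  have "holomorphic_map_on (\<lambda>z. inverse (g z) *s (C *v V z)) (ball 0 1)"
    by (rule holomorphic_map_onI)
       (simp add: complex_differentiable_mult complex_differentiable_inverse g
          complex_differentiable_polys polys_deg_le_polys[OF poly])
  then have "sphere_map (\<lambda>z. C *v V z) g \<longleftrightarrow>
      (\<forall>z \<in> sphere 0 1. (norm (C *v V z))\<^sup>2 = (cmod (g z))\<^sup>2)"
    unfolding sphere_map_def using g(1,3) polys_deg_le_polys[OF poly]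
    by (auto intro!: exI[of _ 0])
  moreover have "(norm (C *v V z))\<^sup>2 = (cmod (g z))\<^sup>2 \<longleftrightarrow>
      herm_form (conj_transpose C ** C) (V z) = of_real ((cmod (g z))\<^sup>2)" for z
    unfolding herm_form_gram of_real_eq_iff ..
  ultimately show ?thesis
    by (simp add: full_rank_maps_def full_rank_spectrahedron_def gram_space_def hermitian_gram
        pos_def_gram_iff full_rank_linear_V_iff normalized_def poly g(3))
qed

section \<open>The maximum principle\<close>

text \<open>Let $F$ be the value of the map at $z$, and $z = rw$ with $\|w\| = 1$. Along the disc
  $\zeta \mapsto \zeta w$ the numerator is divisible by $\zeta$, since it vanishes at the origin.
  Dividing by $\zeta$ and pairing with $F$ gives a holomorphic function $h$ that is bounded by $\|F\|$
  on the unit circle, hence in the disc; at $\zeta = r$ this reads $\|F\|^2 = r\,|h(r)| \le r\,\|F\|$.\<close>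

lemma linear_V_maps_into_ball:
  fixes C :: "complex^9^'n"
  assumes g: "g \<in> polys" "\<And>z. z \<in> cball 0 1 \<Longrightarrow> g z \<noteq> 0"
    and sphere: "\<And>z. z \<in> sphere 0 1 \<Longrightarrow> (norm (C *v V z))\<^sup>2 = (cmod (g z))\<^sup>2"
    and z: "z \<in> ball 0 1"
  shows "norm (inverse (g z) *s (C *v V z)) < 1"
proof (cases "z = 0")
  case True
  then show ?thesis by simp
next
  case False
  define r where "r = norm z"
  have r: "0 < r" "r < 1" using False z by (simp_all add: r_def)
  define w where "w = of_real (inverse r) *s z"
  have nscale: "norm (c *s v) = cmod c * norm v" for c and v :: "complex^'k"
    by (simp add: norm_vec_def L2_set_def norm_mult power_mult_distrib real_sqrt_mult
        flip: sum_distrib_left)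
  have nw: "norm w = 1" using r by (simp add: w_def nscale norm_inverse flip: r_def)
  have zw: "z = of_real r *s w" using r by (simp add: w_def vec_eq_iff)
  define F where "F = inverse (g z) *s (C *v V z)"
  define Q where "Q \<zeta> = (\<chi> i. \<zeta> ^ (mdeg i - 1) * V w $ i)" for \<zeta>
  have VQ: "V (\<zeta> *s w) = \<zeta> *s Q \<zeta>" for \<zeta>
  proof -
    have "\<zeta> ^ mdeg i = \<zeta> * \<zeta> ^ (mdeg i - 1)" for i
      using mdeg_cases[of i] by (metis One_nat_def Suc_pred' gr0I numeral_eq_iff power_Suc zero_neq_numeral zero_neq_one)
    then show ?thesis by (simp add: vec_eq_iff V_scale Q_def)
  qed
  define h where "h \<zeta> = cinner F (C *v Q \<zeta>) / g (\<zeta> *s w)" for \<zeta>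
  have ng: "g (\<zeta> *s w) \<noteq> 0" if "cmod \<zeta> \<le> 1" for \<zeta>
    using that by (intro g(2)) (simp add: nscale nw)
  obtain d c where gc: "\<And>z. g z = (\<Sum>(i, j) \<in> {(i, j). i + j \<le> d}. c i j * (z $ 1) ^ i * (z $ 2) ^ j)"
    using g(1) by (auto simp: polys_def polys_deg_le_def)
  have holg: "(\<lambda>\<zeta>. g (\<zeta> *s w)) holomorphic_on S" for S
    unfolding gc case_prod_unfold vector_smult_component by (intro holomorphic_intros)
  have holn: "(\<lambda>\<zeta>. cinner F (C *v Q \<zeta>)) holomorphic_on S" for S
    unfolding cinner_def matrix_vector_mult_def Q_def vec_lambda_beta by (intro holomorphic_intros)
  have hol: "h holomorphic_on cball 0 1"
    unfolding h_def using ng by (intro holomorphic_on_divide holg holn) auto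
  have "cmod (h (of_real r)) \<le> norm F"
  proof (rule maximum_modulus_frontier[of h "cball 0 1"])
    show "h holomorphic_on interior (cball 0 1)"
      by (rule holomorphic_on_subset[OF hol]) (rule interior_subset)
    show "continuous_on (closure (cball 0 1)) h"
      using holomorphic_on_imp_continuous_on[OF hol] by simp
    fix \<zeta> :: complex assume "\<zeta> \<in> frontier (cball 0 1)"
    then have u: "cmod \<zeta> = 1" by simp
    have "norm (\<zeta> *s w) = 1" by (simp add: nscale u nw)
    then have "norm (C *v V (\<zeta> *s w)) = cmod (g (\<zeta> *s w))"
      using sphere[of "\<zeta> *s w"] by simp
    then have eq: "norm (C *v Q \<zeta>) = cmod (g (\<zeta> *s w))"
      by (simp add: VQ vector_scalar_commute nscale u)
    have "cmod (cinner F (C *v Q \<zeta>)) \<le> norm F * cmod (g (\<zeta> *s w))"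
      using norm_cinner_le[of F "C *v Q \<zeta>"] by (simp add: eq)
    then show "cmod (h \<zeta>) \<le> norm F"
      using ng[of \<zeta>] u by (simp add: h_def norm_divide divide_le_eq)
  qed (use r in auto)
  moreover have "cinner F F = of_real r * h (of_real r)"
  proof -
    have "F = inverse (g z) *s (of_real r *s (C *v Q (of_real r)))"
      unfolding F_def by (subst zw, subst VQ) (simp add: zw[symmetric] vector_scalar_commute)
    then have "cinner F F = inverse (g z) * (of_real r * cinner F (C *v Q (of_real r)))"
      by (metis cinner_scale_right)
    then show ?thesis by (simp add: h_def divide_inverse flip: zw)
  qed
  then have "(norm F)\<^sup>2 = r * cmod (h (of_real r))"
    using r by (metis abs_of_pos cinner_self norm_mult norm_of_real abs_of_nonneg zero_le_power2)
  ultimately have "(norm F)\<^sup>2 \<le> r * norm F" using r by simp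
  then have "norm F \<le> r"
    using r by (cases "norm F = 0") (auto simp: power2_eq_square)
  then show ?thesis using r by (simp add: F_def)
qed

section \<open>Unitary equivalence and enlarging the target\<close>

text \<open>Since the coefficient matrices $C$ and $D$ of \<open>P\<close> and \<open>Q\<close> are unique, $Q = UP$ means
  $D = UC$, and such a unitary $U$ exists exactly when $C^* C = D^* D$.\<close>

lemma unitary_equiv_iff_gram_eq:
  fixes P Q :: "complex^2 \<Rightarrow> complex^'n"
  assumes P: "P \<in> full_rank_maps g" and Q: "Q \<in> full_rank_maps g"
  shows "(P, Q) \<in> unitary_equiv g \<longleftrightarrow> gram P = gram Q"
proof -
  obtain C D where C: "P = (\<lambda>z. C *v V z)" and D: "Q = (\<lambda>z. D *v V z)"
    using full_rank_maps_linear_V[OF P] full_rank_maps_linear_V[OF Q] by metis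
  have "(P, Q) \<in> unitary_equiv g \<longleftrightarrow> (\<exists>U. unitary U \<and> (\<forall>z. D *v V z = (U ** C) *v V z))"
    using P Q by (auto simp: unitary_equiv_def C D fun_eq_iff matrix_vector_mul_assoc)
  also have "\<dots> \<longleftrightarrow> (\<exists>U. unitary U \<and> D = U ** C)"
    by (metis V_independent)
  also have "\<dots> \<longleftrightarrow> conj_transpose C ** C = conj_transpose D ** D"
  proof
    assume "\<exists>U. unitary U \<and> D = U ** C"
    then obtain U where U: "conj_transpose U ** U = mat 1" and D: "D = U ** C"
      by (auto simp: unitary_def)
    have "conj_transpose D ** D = conj_transpose C ** (conj_transpose U ** U) ** C"
      by (simp add: D conj_transpose_mult matrix_mul_assoc)
    then show "conj_transpose C ** C = conj_transpose D ** D" by (simp add: U)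
  qed (rule gram_eq_imp_unitary)
  finally show ?thesis by (simp add: C D gram_linear_V)
qed

lemma equiv_unitary_equiv:
  "equiv (full_rank_maps g) (unitary_equiv g :: ((complex^2 \<Rightarrow> complex^'n) \<times> _) set)"
proof (rule equivI)
  show sub: "unitary_equiv g \<subseteq> full_rank_maps g \<times> (full_rank_maps g :: (complex^2 \<Rightarrow> complex^'n) set)"
    by (auto simp: unitary_equiv_def)
  note iff = unitary_equiv_iff_gram_eq
  show "refl_on (full_rank_maps g) (unitary_equiv g :: ((complex^2 \<Rightarrow> complex^'n) \<times> _) set)"
    by (rule refl_onI) (simp add: iff)
  show "sym (unitary_equiv g :: ((complex^2 \<Rightarrow> complex^'n) \<times> _) set)"
  proof (rule symI)
    fix P Q :: "complex^2 \<Rightarrow> complex^'n" assume PQ: "(P, Q) \<in> unitary_equiv g"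
    with sub have "P \<in> full_rank_maps g" "Q \<in> full_rank_maps g" by auto
    with PQ show "(Q, P) \<in> unitary_equiv g" by (simp add: iff)
  qed
  show "trans (unitary_equiv g :: ((complex^2 \<Rightarrow> complex^'n) \<times> _) set)"
  proof (rule transI)
    fix P Q R :: "complex^2 \<Rightarrow> complex^'n"
    assume PQ: "(P, Q) \<in> unitary_equiv g" and QR: "(Q, R) \<in> unitary_equiv g"
    with sub have "P \<in> full_rank_maps g" "Q \<in> full_rank_maps g" "R \<in> full_rank_maps g" by auto
    with PQ QR show "(P, R) \<in> unitary_equiv g" by (simp add: iff)
  qed
qed

lemma adjoin_zeros_linear_V:
  "adjoin_zeros \<iota> (\<lambda>z. C *v V z) = (\<lambda>z. (\<chi> k. if k \<in> range \<iota> then C $ inv \<iota> k else 0) *v V z)"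
  by (auto simp: adjoin_zeros_def fun_eq_iff vec_eq_iff matrix_vector_mult_def)

lemma gram_adjoin_zero_rows:
  fixes C :: "complex^'k^'m" and \<iota> :: "'m \<Rightarrow> 'n :: finite"
  assumes "inj \<iota>"
  defines "D \<equiv> (\<chi> k. if k \<in> range \<iota> then C $ inv \<iota> k else 0) :: complex^'k^'n"
  shows "conj_transpose D ** D = conj_transpose C ** C"
proof -
  have "(conj_transpose D ** D) $ i $ j = (conj_transpose C ** C) $ i $ j" for i j
  proof -
    have "(\<Sum>k\<in>UNIV. cnj (D $ k $ i) * D $ k $ j) = (\<Sum>k\<in>range \<iota>. cnj (D $ k $ i) * D $ k $ j)"
      by (rule sum.mono_neutral_right) (auto simp: D_def)
    also have "\<dots> = (\<Sum>m\<in>UNIV. cnj (C $ m $ i) * C $ m $ j)"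
      using assms(1) by (simp add: sum.reindex D_def)
    finally show ?thesis by (simp add: matrix_matrix_mult_def)
  qed
  then show ?thesis by (simp add: vec_eq_iff)
qed

lemma inj_matrix_card_le:
  fixes C :: "complex^'m^'n"
  assumes "inj ((*v) C)"
  shows "CARD('m) \<le> CARD('n)"
proof -
  have "linear ((*v) C)" by simp
  then have "dim (range ((*v) C)) = dim (UNIV :: (complex^'m) set)"
    using assms by (intro dim_image_eq) simp_all
  then have "DIM(complex^'m) \<le> DIM(complex^'n)" using dim_subset_UNIV[of "range ((*v) C)"] by simp
  then show ?thesis by simp
qed

text \<open>A Cholesky factor with nine rows is padded by zero rows.\<close>

lemma full_rank_spectrahedron_factors:
  assumes "H \<in> full_rank_spectrahedron g" and "9 \<le> CARD('n)"
  shows "\<exists>C :: complex^9^'n. conj_transpose C ** C = H"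
proof -
  obtain B :: "complex^9^9" where B: "conj_transpose B ** B = H"
    using assms(1) pos_def_cholesky by (auto simp: full_rank_spectrahedron_def)
  obtain \<iota> :: "9 \<Rightarrow> 'n" where "inj \<iota>"
    using card_le_inj[of "UNIV :: 9 set" "UNIV :: 'n set"] assms(2) by auto
  from gram_adjoin_zero_rows[OF this, of B] B show ?thesis by (intro exI) (erule trans)
qed

lemma gram_image_class:
  fixes P :: "complex^2 \<Rightarrow> complex^'n"
  assumes "P \<in> full_rank_maps g"
  shows "gram ` (unitary_equiv g `` {P}) = {gram P}"
proof -
  have "P \<in> unitary_equiv g `` {P}"
    using assms by (simp add: unitary_equiv_iff_gram_eq)
  moreover have "gram Q = gram P" if "Q \<in> unitary_equiv g `` {P}" for Q
    using that assms unitary_equiv_iff_gram_eq[of P g Q] by (auto simp: unitary_equiv_def)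
  ultimately show ?thesis by blast
qed

text \<open>Equal Gram matrices mean equal classes, which gives injectivity; surjectivity is the existence of a
  factor.\<close>

lemma bij_betw_classes_spectrahedron:
  assumes g: "g \<in> polys" "\<forall>z \<in> ball 0 1. g z \<noteq> 0" "g 0 = 1"
    and "9 \<le> CARD('n)"
  shows "bij_betw (\<lambda>X. the_elem (gram ` X))
    ((full_rank_maps g :: (complex^2 \<Rightarrow> complex^'n) set) // unitary_equiv g)
    (full_rank_spectrahedron g)"
proof (rule bij_betwI')
  let ?A = "full_rank_maps g :: (complex^2 \<Rightarrow> complex^'n) set"
  fix X assume "X \<in> ?A // unitary_equiv g"
  then obtain P where P: "P \<in> ?A" "X = unitary_equiv g `` {P}" by (rule quotientE)
  then have gX: "the_elem (gram ` X) = gram P" by (simp add: gram_image_class)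
  obtain C where C: "P = (\<lambda>z. C *v V z)" using P(1) by (rule full_rank_maps_linear_V)
  show "the_elem (gram ` X) \<in> full_rank_spectrahedron g"
    using P(1) linear_V_full_rank_maps_iff[OF g, of C] by (simp add: gX C gram_linear_V)
  fix Y assume "Y \<in> ?A // unitary_equiv g"
  then obtain Q where Q: "Q \<in> ?A" "Y = unitary_equiv g `` {Q}" by (rule quotientE)
  then have gY: "the_elem (gram ` Y) = gram Q" by (simp add: gram_image_class)
  have "X = Y \<longleftrightarrow> gram P = gram Q"
    unfolding P(2) Q(2) eq_equiv_class_iff[OF equiv_unitary_equiv P(1) Q(1)]
    using P(1) Q(1) by (rule unitary_equiv_iff_gram_eq)
  then show "the_elem (gram ` X) = the_elem (gram ` Y) \<longleftrightarrow> X = Y"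
    unfolding gX gY by blast
next
  fix H assume H: "H \<in> full_rank_spectrahedron g"
  then obtain C :: "complex^9^'n" where C: "conj_transpose C ** C = H"
    using full_rank_spectrahedron_factors assms(4) by blast
  then have P: "(\<lambda>z. C *v V z) \<in> full_rank_maps g"
    using H linear_V_full_rank_maps_iff[OF g, of C] by simp
  show "\<exists>X \<in> (full_rank_maps g :: (complex^2 \<Rightarrow> complex^'n) set) // unitary_equiv g.
      H = the_elem (gram ` X)"
    by (rule bexI[OF _ quotientI[OF P]]) (simp add: gram_image_class[OF P] gram_linear_V C)
qed

section \<open>The denominator and the parametrization\<close>

lemma g_sigma_polys: "g_sigma \<sigma>1 \<sigma>2 \<in> polys"
proof -
  have "finite {(i, j). i + j \<le> (2::nat)}"
    by (rule finite_subset[of _ "{..2} \<times> {..2}"]) auto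
  then have "g_sigma \<sigma>1 \<sigma>2 z = (\<Sum>(i, j) \<in> {(i, j). i + j \<le> 2}.
      (if (i, j) = (0, 0) then 1 else if (i, j) = (2, 0) then of_real \<sigma>1
       else if (i, j) = (0, 2) then of_real \<sigma>2 else 0) * (z $ 1) ^ i * (z $ 2) ^ j)" for z
    by (subst sum.mono_neutral_right[of _ "{(0, 0), (2, 0), (0, 2)}"])
       (auto simp: g_sigma_def split: if_splits)
  then have "g_sigma \<sigma>1 \<sigma>2 \<in> polys_deg_le 2" by (auto simp only: polys_deg_le_def)
  then show ?thesis by (rule polys_deg_le_polys)
qed

lemma g_sigma_nonzero:
  assumes "0 \<le> \<sigma>2" "\<sigma>2 \<le> \<sigma>1" "\<sigma>1 < 1" and z: "z \<in> cball 0 1"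
  shows "g_sigma \<sigma>1 \<sigma>2 z \<noteq> 0"
proof
  assume "g_sigma \<sigma>1 \<sigma>2 z = 0"
  then have "of_real \<sigma>1 * (z $ 1)\<^sup>2 + of_real \<sigma>2 * (z $ 2)\<^sup>2 = - 1"
    by (simp add: g_sigma_def add_eq_0_iff algebra_simps)
  then have "1 = cmod (of_real \<sigma>1 * (z $ 1)\<^sup>2 + of_real \<sigma>2 * (z $ 2)\<^sup>2)" by simp
  also have "\<dots> \<le> cmod (of_real \<sigma>1 * (z $ 1)\<^sup>2) + cmod (of_real \<sigma>2 * (z $ 2)\<^sup>2)"
    by (rule norm_triangle_ineq)
  also have "\<dots> = \<sigma>1 * (cmod (z $ 1))\<^sup>2 + \<sigma>2 * (cmod (z $ 2))\<^sup>2"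
    using assms by (simp add: norm_mult norm_power)
  also have "\<dots> \<le> \<sigma>1 * (norm z)\<^sup>2"
    unfolding norm_sq_complex2 using assms by (simp add: distrib_left mult_right_mono)
  also have "\<dots> \<le> \<sigma>1 * 1"
    using assms by (intro mult_left_mono) (simp_all add: power_le_one)
  finally show False using assms by simp
qed

lemma gram_space_affine: "affine (gram_space g)"
  unfolding affine_def gram_space_def
  by (auto simp: hermitian_add hermitian_scaleR herm_form_add herm_form_scaleR
      simp flip: distrib_right of_real_add)

text \<open>Positive definiteness is an open condition among the Hermitian matrices.\<close>

lemma full_rank_spectrahedron_openin:
  "openin (top_of_set (gram_space g)) (full_rank_spectrahedron g)"
proof -
  obtain U :: "(complex^9^9) set" where U: "open U" "\<And>H. pos_def H \<longleftrightarrow> hermitian H \<and> H \<in> U"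
    using pos_def_relatively_open by blast
  then have "full_rank_spectrahedron g = gram_space g \<inter> U"
    by (auto simp: full_rank_spectrahedron_def gram_space_def)
  then show ?thesis using U(1) by (auto simp: openin_open)
qed

theorem proposition5p3:
  fixes \<sigma>1 \<sigma>2 :: real and g :: "complex^2 \<Rightarrow> complex"
  assumes "0 \<le> \<sigma>2" and "\<sigma>2 \<le> \<sigma>1" and "\<sigma>1 < 1"
    and "sqrt (1 - \<sigma>1\<^sup>2) + sqrt (1 - \<sigma>2\<^sup>2) > 1"
    and g_def: "g = g_sigma \<sigma>1 \<sigma>2"
  shows
    "affine (gram_space g) \<and> aff_dim (gram_space g) = 25 \<and>
     full_rank_spectrahedron g \<noteq> {} \<and>
     openin (top_of_set (gram_space g)) (full_rank_spectrahedron g) \<and>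
     \<comment> \<open>maps to an arbitrary finite-dimensional target, the case of the target of dimension 9
         included\<close>
     (\<forall>P \<in> (full_rank_maps g :: (complex^2 \<Rightarrow> complex^'n) set).
        9 \<le> CARD('n) \<and>
        (\<lambda>z. inverse (g z) *s P z) ` ball 0 1 \<subseteq> ball 0 1 \<and>
        (\<exists>!C :: complex^9^'n. P = (\<lambda>z. C *v V z))) \<and>
     (\<forall>C :: complex^9^'n.
        gram (\<lambda>z. C *v V z) = conj_transpose C ** C \<and>
        ((\<lambda>z. C *v V z) \<in> full_rank_maps g \<longleftrightarrow>
           conj_transpose C ** C \<in> full_rank_spectrahedron g)) \<and>
     equiv (full_rank_maps g) (unitary_equiv g ::
        ((complex^2 \<Rightarrow> complex^'n) \<times> (complex^2 \<Rightarrow> complex^'n)) set) \<and>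
     (\<forall>P \<in> full_rank_maps g. \<forall>Q \<in> full_rank_maps g.
        (P, Q) \<in> (unitary_equiv g ::
          ((complex^2 \<Rightarrow> complex^'n) \<times> (complex^2 \<Rightarrow> complex^'n)) set) \<longleftrightarrow>
        gram P = gram Q) \<and>
     (9 \<le> CARD('n) \<longrightarrow>
        bij_betw (\<lambda>X. the_elem (gram ` X))
          ((full_rank_maps g :: (complex^2 \<Rightarrow> complex^'n) set) // unitary_equiv g)
          (full_rank_spectrahedron g)) \<and>
     \<comment> \<open>stability under enlarging the target\<close>
     (\<forall>\<iota> :: 9 \<Rightarrow> 'n. inj \<iota> \<longrightarrow>
        (\<forall>Q \<in> full_rank_maps g.
           adjoin_zeros \<iota> Q \<in> full_rank_maps g \<and> gram (adjoin_zeros \<iota> Q) = gram Q) \<and>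
        (\<forall>P \<in> full_rank_maps g. \<exists>Q \<in> full_rank_maps g.
           (adjoin_zeros \<iota> Q, P) \<in> unitary_equiv g))"
proof -
  have g_polys: "g \<in> polys" and g_one: "g 0 = 1"
    unfolding g_def by (rule g_sigma_polys) (simp add: g_sigma_def)
  have g_nonzero: "g z \<noteq> 0" if "z \<in> cball 0 1" for z
    unfolding g_def using assms(1-3) that by (rule g_sigma_nonzero)
  then have g_nonzero': "\<forall>z \<in> ball 0 1. g z \<noteq> 0" by simp
  note iff = linear_V_full_rank_maps_iff[OF g_polys g_nonzero' g_one]
  obtain a b \<delta> where "pos_def (parity_gram \<sigma>1 \<sigma>2 a b \<delta>)"
    using pos_def_parity_gram[OF assms(1-4)] by blast
  then obtain H0 where H0: "H0 \<in> full_rank_spectrahedron g"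
    using parity_gram_in_gram_space[of \<sigma>1 \<sigma>2 a b \<delta>]
    by (simp add: full_rank_spectrahedron_def g_def)
  then have "gram_space g = (+) H0 ` gram_kernel"
    by (intro gram_space_translate) (simp add: full_rank_spectrahedron_def)
  then have dim: "aff_dim (gram_space g) = 25"
    by (simp add: aff_dim_translation_eq aff_dim_subspace subspace_gram_kernel dim_gram_kernel)
  have maps: "9 \<le> CARD('n) \<and> (\<lambda>z. inverse (g z) *s P z) ` ball 0 1 \<subseteq> ball 0 1 \<and>
      (\<exists>!C :: complex^9^'n. P = (\<lambda>z. C *v V z))"
    if P: "P \<in> full_rank_maps g" for P :: "complex^2 \<Rightarrow> complex^'n"
  proof -
    obtain C where C: "P = (\<lambda>z. C *v V z)" using P by (rule full_rank_maps_linear_V)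
    have "full_rank P" using P by (simp add: full_rank_maps_def)
    then have "CARD(9) \<le> CARD('n)"
      unfolding C full_rank_linear_V_iff by (rule inj_matrix_card_le)
    moreover have "(norm (C *v V z))\<^sup>2 = (cmod (g z))\<^sup>2" if "z \<in> sphere 0 1" for z
      using P that by (simp add: C full_rank_maps_def sphere_map_def)
    then have "norm (inverse (g z) *s (C *v V z)) < 1" if "z \<in> ball 0 1" for z
      using that by (intro linear_V_maps_into_ball g_polys g_nonzero)
    then have "(\<lambda>z. inverse (g z) *s P z) ` ball 0 1 \<subseteq> ball 0 1" by (auto simp: C)
    moreover have "\<exists>!D :: complex^9^'n. P = (\<lambda>z. D *v V z)"
      using C by (intro ex1I[of _ C]) (auto simp: fun_eq_iff intro: V_independent)
    ultimately show ?thesis by simp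
  qed
  have adjoin: "adjoin_zeros \<iota> Q \<in> full_rank_maps g \<and> gram (adjoin_zeros \<iota> Q) = gram Q"
    if "inj \<iota>" and Q: "Q \<in> full_rank_maps g" for \<iota> :: "9 \<Rightarrow> 'n" and Q :: "complex^2 \<Rightarrow> complex^9"
  proof -
    obtain C where C: "Q = (\<lambda>z. C *v V z)" using Q by (rule full_rank_maps_linear_V)
    define D :: "complex^9^'n" where "D = (\<chi> k. if k \<in> range \<iota> then C $ inv \<iota> k else 0)"
    have D: "adjoin_zeros \<iota> Q = (\<lambda>z. D *v V z)"
      unfolding C D_def by (rule adjoin_zeros_linear_V)
    have DC: "conj_transpose D ** D = conj_transpose C ** C"
      unfolding D_def using that(1) by (rule gram_adjoin_zero_rows)
    show ?thesis
      using Q unfolding D unfolding C gram_linear_V DC[symmetric] by (simp add: iff DC)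
  qed
  have adjoin_surj: "\<exists>Q \<in> full_rank_maps g. (adjoin_zeros \<iota> Q, P) \<in> unitary_equiv g"
    if "inj \<iota>" and P: "P \<in> full_rank_maps g" for \<iota> :: "9 \<Rightarrow> 'n" and P :: "complex^2 \<Rightarrow> complex^'n"
  proof -
    obtain C where C: "P = (\<lambda>z. C *v V z)" using P by (rule full_rank_maps_linear_V)
    \<comment> \<open>A square factor of the Gram matrix of \<open>P\<close> defines \<open>Q\<close>.\<close>
    have H: "conj_transpose C ** C \<in> full_rank_spectrahedron g" using P unfolding C iff .
    then obtain B :: "complex^9^9" where B: "conj_transpose B ** B = conj_transpose C ** C"
      using full_rank_spectrahedron_factors[of _ g, where 'n = 9] by auto
    define Q where "Q = (\<lambda>z. B *v V z)"
    have Q: "Q \<in> full_rank_maps g" unfolding Q_def iff B by (rule H)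
    have "gram (adjoin_zeros \<iota> Q) = gram P"
      using adjoin[OF that(1) Q] by (simp add: Q_def C gram_linear_V B)
    then have "(adjoin_zeros \<iota> Q, P) \<in> unitary_equiv g"
      using adjoin[OF that(1) Q] P by (simp add: unitary_equiv_iff_gram_eq)
    with Q show ?thesis by blast
  qed
  show ?thesis
  proof (intro conjI)
    show "full_rank_spectrahedron g \<noteq> {}" using H0 by blast
    show "\<forall>C :: complex^9^'n. gram (\<lambda>z. C *v V z) = conj_transpose C ** C \<and>
        ((\<lambda>z. C *v V z) \<in> full_rank_maps g \<longleftrightarrow>
           conj_transpose C ** C \<in> full_rank_spectrahedron g)"
      by (simp add: gram_linear_V iff)
    show "\<forall>P \<in> full_rank_maps g. \<forall>Q \<in> full_rank_maps g.
        (P, Q) \<in> (unitary_equiv g ::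
          ((complex^2 \<Rightarrow> complex^'n) \<times> (complex^2 \<Rightarrow> complex^'n)) set) \<longleftrightarrow>
        gram P = gram Q"
      by (simp add: unitary_equiv_iff_gram_eq)
    show "9 \<le> CARD('n) \<longrightarrow>
        bij_betw (\<lambda>X. the_elem (gram ` X))
          ((full_rank_maps g :: (complex^2 \<Rightarrow> complex^'n) set) // unitary_equiv g)
          (full_rank_spectrahedron g)"
      using bij_betw_classes_spectrahedron[OF g_polys g_nonzero' g_one] by blast
  qed (use maps adjoin adjoin_surj in
      \<open>simp_all add: gram_space_affine dim full_rank_spectrahedron_openin equiv_unitary_equiv\<close>)
qed

end
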